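(* Let $A$ and $C$ be matrices in $\mathbb{C}^{d\times d}$, with $C+kI$ invertible for all integers $k\ge0$. Then the matrix function $\mathcal{H}_5(A;C;x,y)$ satisfies the following differential formulae, where $r$ is a positive integer: (1) $\dfrac{\partial^r}{\partial x^r}\mathcal{H}_5(A;C;x,y)=(A)_r\,\mathcal{H}_5(A+rI;C+rI;x,y)\,(C)_r^{-1}$; (2) $\dfrac{\partial^r}{\partial y^r}\mathcal{H}_5(A;C;x,y)=(-1)^r(I-A)_r^{-1}\,\mathcal{H}_5(A-rI;C;x,y)$; (3) $\Big(x^2\dfrac{\partial}{\partial x}\Big)^r\big[x^{A+(r-1)I}\mathcal{H}_5(A;C;x,\tfrac{y}{x})\big]=x^{A+rI}(A)_r\,\mathcal{H}_5(A+rI;C;x,\tfrac{y}{x})$; (4) $\dfrac{\partial^r}{\partial x^r}\big[\mathcal{H}_5(A;C;x,y)\,x^{C-I}\big]=(-1)^r\,\mathcal{H}_5(A;C-rI;x,y)\,x^{C-(r+1)I}(I-C)_r$.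
   Context: $\mathcal{H}_5(A;C;x,y)=\sum_{m,n\ge0}(A)_{m-n}(C)_m^{-1}\frac{x^m y^n}{m!\,n!}$. Matrix Pochhammer symbol: for $M\in\mathbb{C}^{d\times d}$, $(M)_0=I$, $(M)_n=M(M+I)\cdots(M+(n-1)I)$ for $n\ge1$, and $(M)_{-n}=(-1)^n(I-M)_n^{-1}$; $(M)_n^{-1}$ is the inverse matrix of $(M)_n$. Matrix powers: $x^M=\exp(M\log x)$.
   Formalization: In (3) the differentiated function is x^A H_5(A;C;x,y/x), since the printed x^{A+(r-1)I} fails for r≥2; invertibility of the matrices A±kI, C−kI needed for each H_5 to be defined is assumed, and in (3),(4) x avoids the closed negative real axis (principal log). *)

theory Defs
  imports "HOL-Complex_Analysis.Complex_Analysis"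
begin

text \<open>
  Matrices in \<open>\<complex>\<^bsup>d\<times>d\<^esup>\<close> are rendered as \<^typ>\<open>complex^'d^'d\<close>. On this type the
  class operations \<open>*\<close>, \<open>^\<close> and \<open>1\<close> are componentwise, so matrix products,
  scalar multiples and \<open>k I\<close> are written \<open>**\<close>, \<open>*k\<close> and \<open>mat k\<close>; the library's
  \<open>exp\<close> is likewise not the matrix exponential.
\<close>

definition mat_scale :: "complex \<Rightarrow> complex^'d^'d \<Rightarrow> complex^'d^'d"  (infixl \<open>*k\<close> 70) where
  "c *k M = (\<chi> i j. c * M $ i $ j)"

primrec mat_pow :: "complex^'d^'d \<Rightarrow> nat \<Rightarrow> complex^'d^'d" where
  "mat_pow M 0 = mat 1"
| "mat_pow M (Suc k) = mat_pow M k ** M"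

definition mat_exp :: "complex^'d^'d \<Rightarrow> complex^'d^'d" where
  "mat_exp M = (\<Sum>k. (1 / fact k) *k mat_pow M k)"

text \<open>\<open>x\<^bsup>M\<^esup>\<close> with the principal branch of the logarithm.\<close>

definition mat_powr :: "complex \<Rightarrow> complex^'d^'d \<Rightarrow> complex^'d^'d" where
  "mat_powr x M = mat_exp (Ln x *k M)"

primrec mat_poch :: "complex^'d^'d \<Rightarrow> nat \<Rightarrow> complex^'d^'d" where
  "mat_poch M 0 = mat 1"
| "mat_poch M (Suc n) = mat_poch M n ** (M + mat (of_nat n))"

definition mat_poch_int :: "complex^'d^'d \<Rightarrow> int \<Rightarrow> complex^'d^'d" where
  "mat_poch_int M k =
     (if k \<ge> 0 then mat_poch M (nat k)
      else (-1) ^ nat (- k) *k matrix_inv (mat_poch (mat 1 - M) (nat (- k))))"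

text \<open>
  The terms with \<open>n > m\<close> involve the inverses of \<open>(I - A)\<^sub>j\<close> for \<open>j \<ge> 1\<close>, so the series is
  meaningful only if \<open>A - k I\<close> is invertible for all \<open>k \<ge> 1\<close> and \<open>C + k I\<close> for all \<open>k \<ge> 0\<close>.
\<close>

definition horn_H5 ::
    "complex^'d^'d \<Rightarrow> complex^'d^'d \<Rightarrow> complex \<Rightarrow> complex \<Rightarrow> complex^'d^'d" where
  "horn_H5 A C x y =
     (\<Sum>\<^sub>\<infinity>(m, n)\<in>UNIV. (x ^ m * y ^ n / (fact m * fact n)) *k
        (mat_poch_int A (int m - int n) ** matrix_inv (mat_poch C m)))"

text \<open>
  Complex differentiation of matrix functions is entrywise. As \<^const>\<open>deriv\<close> is total, statements
  about \<open>mat_deriv\<close> should come with \<open>mat_holomorphic_on\<close>, which on an open set guarantees that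
  derivatives of all orders exist.
\<close>

definition mat_holomorphic_on :: "(complex \<Rightarrow> complex^'d^'d) \<Rightarrow> complex set \<Rightarrow> bool" where
  "mat_holomorphic_on F S \<longleftrightarrow> (\<forall>i j. (\<lambda>z. F z $ i $ j) holomorphic_on S)"

definition mat_deriv :: "(complex \<Rightarrow> complex^'d^'d) \<Rightarrow> complex \<Rightarrow> complex^'d^'d" where
  "mat_deriv F x = (\<chi> i j. deriv (\<lambda>z. F z $ i $ j) x)"

end

theory Submission
  imports Defs
begin

text \<open>
  Why the formulae hold. The series is a double exponential generating function
  \<open>\<Sum> a(m,n) x\<^sup>m y\<^sup>n / (m! n!)\<close> with matrix coefficients
  \<open>a(m,n) = (A)\<^bsub>m-n\<^esub> (C)\<^sub>m\<^sup>-\<^sup>1\<close>. Such a series is differentiated by shifting an index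
  of \<open>a\<close>, and the operators \<open>x \<partial>/\<partial>x\<close> and \<open>y \<partial>/\<partial>y\<close> multiply \<open>a(m,n)\<close> by \<open>m\<close> and \<open>n\<close>
  (lemmas \<open>egf_chain_rule\<close> and \<open>egf_euler\<close>). The case \<open>r = 1\<close> of each formula therefore amounts to a
  relation between coefficients, and all of these come from two facts: the recurrences
  \<open>(A)\<^bsub>k+1\<^esub> = (A)\<^sub>k (A + kI) = A (A + I)\<^sub>k\<close>, valid for every integer \<open>k\<close> (lemmas
  \<open>mat_poch_int_step\<close> and \<open>mat_poch_int_Suc_left\<close>), and their counterparts for \<open>(C)\<^sub>m\<close>.
  The matrices \<open>A\<close> and \<open>C\<close> need not commute. In the coefficients every factor built from \<open>A\<close> stands
  to the left of every factor built from \<open>C\<close>, and only factors built from the same matrix are ever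
  interchanged; this is why matrices produced by \<open>A\<close> come out on the left of the series and those
  produced by \<open>C\<close> on its right.

  Termwise differentiation requires bounds. Since \<open>(C + nI)\<^sup>-\<^sup>1 = O(1/n)\<close>, the inverse of \<open>(C)\<^sub>m\<close> is at
  most \<open>K\<^bsup>m+1\<^esup> / m!\<close>, while \<open>(A)\<^bsub>m-n\<^esub>\<close> is at most \<open>K\<^bsup>m+n+1\<^esup> m!\<close>; the
  factorials cancel and the coefficients grow at most geometrically (\<open>H5_coeff_bounded\<close>). The terms
  are then dominated by those of a product of two exponential series, uniformly for \<open>x\<close> and \<open>y\<close> in a
  bounded set, so the series converges to a function on all of \<open>\<complex>\<^sup>2\<close> that can be composed with
  holomorphic functions and differentiated term by term. Composition is what handles the argument
  \<open>y / x\<close> of the third formula.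

  Matrix powers fit the same frame, because \<open>exp (x M)\<close> is the generating function with coefficients
  \<open>M\<^sup>m\<close> at \<open>y = 0\<close>. The law \<open>x\<^bsup>M+I\<^esup> = x x\<^bsup>M\<^esup>\<close> follows from uniqueness for the linear
  equation \<open>H' = M H\<close>. The formulae of order \<open>r\<close> follow by iterating those of order one: the
  parameters that arise at each step again satisfy the invertibility conditions, and the factors split
  off accumulate to Pochhammer symbols.
\<close>

(* From here on the dollar sign denotes vector components only. *)
unbundle no fps_syntax

section \<open>Double exponential generating functions\<close>

definition cegf :: "(nat \<Rightarrow> nat \<Rightarrow> complex) \<Rightarrow> complex \<Rightarrow> complex \<Rightarrow> complex" where
  "cegf c x y = (\<Sum>\<^sub>\<infinity>(m, n)\<in>UNIV. x ^ m * y ^ n / (fact m * fact n) * c m n)"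

text \<open>
  A bound on the norms of coefficients, so the same notion serves scalars and matrices. The extra
  \<open>1\<close> in the exponent absorbs a constant factor.
\<close>

definition geom_bounded :: "(nat \<Rightarrow> nat \<Rightarrow> real) \<Rightarrow> bool" where
  "geom_bounded b \<longleftrightarrow> (\<exists>K\<ge>1. \<forall>m n. b m n \<le> K ^ (m + n + 1))"

lemma geom_bounded_shift:
  assumes "geom_bounded b"
  shows "geom_bounded (\<lambda>m n. b (m + i) (n + j))"
proof -
  obtain K :: real where K: "K \<ge> 1" "\<And>m n. b m n \<le> K ^ (m + n + 1)"
    using assms unfolding geom_bounded_def by auto
  have "b (m + i) (n + j) \<le> (K ^ (i + j + 1)) ^ (m + n + 1)" for m n
  proof -
    have "b (m + i) (n + j) \<le> K ^ (m + i + (n + j) + 1)" by (rule K(2))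
    also have "\<dots> \<le> K ^ ((i + j + 1) * (m + n + 1))"
      using K(1) by (intro power_increasing) (auto simp: algebra_simps)
    finally show ?thesis by (simp only: power_mult)
  qed
  moreover have "K ^ (i + j + 1) \<ge> 1" using K(1) by (rule one_le_power)
  ultimately show ?thesis unfolding geom_bounded_def by blast
qed

lemma geom_bounded_Suc:
  assumes "geom_bounded b"
  shows "geom_bounded (\<lambda>m n. b (Suc m) n)" "geom_bounded (\<lambda>m n. b m (Suc n))"
  using geom_bounded_shift[OF assms, of 1 0] geom_bounded_shift[OF assms, of 0 1]
  by simp_all

lemma geom_bounded_swap:
  assumes "geom_bounded b"
  shows "geom_bounded (\<lambda>m n. b n m)"
proof -
  obtain K :: real where K: "K \<ge> 1" "\<And>m n. b m n \<le> K ^ (m + n + 1)"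
    using assms unfolding geom_bounded_def by auto
  have "b n m \<le> K ^ (m + n + 1)" for m n using K(2)[of n m] by (simp only: add.commute)
  thus ?thesis using K(1) unfolding geom_bounded_def by blast
qed

lemma double_exp_summable:
  fixes a b :: real
  assumes "a \<ge> 0" "b \<ge> 0"
  shows "(\<lambda>(m, n). a ^ m / fact m * (b ^ n / fact n)) summable_on (UNIV :: (nat \<times> nat) set)"
proof -
  have exp: "((\<lambda>n. t ^ n / fact n) has_sum exp t) UNIV" if "t \<ge> 0" for t :: real
    using norm_summable_imp_has_sum[OF summable_norm_exp[of t] exp_converges[of t]] that
    by (simp add: divide_inverse mult.commute)
  have "(\<lambda>(m, n). a ^ m / fact m * (b ^ n / fact n)) summable_on (UNIV \<times> (UNIV :: nat set))"
  proof (rule summable_on_SigmaI)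
    show "((\<lambda>n. case (m, n) of (m, n) \<Rightarrow> a ^ m / fact m * (b ^ n / fact n)) has_sum
            a ^ m / fact m * exp b) UNIV" for m
      using has_sum_cmult_right[OF exp[OF assms(2)], of "a ^ m / fact m"] by simp
    show "(\<lambda>m. a ^ m / fact m * exp b) summable_on UNIV"
      using has_sum_cmult_left[OF exp[OF assms(1)], of "exp b"] by (auto simp: summable_on_def)
  qed (use assms in auto)
  thus ?thesis by simp
qed

lemma cegf_term_le:
  fixes x y :: complex
  assumes "norm (c m n) \<le> K ^ (m + n + 1)" "norm x \<le> R" "norm y \<le> R'" "K \<ge> 1"
  shows "norm (x ^ m * y ^ n / (fact m * fact n) * c m n)
    \<le> K * ((K * R) ^ m / fact m * ((K * R') ^ n / fact n))"
proof -
  have "norm (x ^ m * y ^ n / (fact m * fact n) * c m n)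
      = (norm x ^ m * norm y ^ n / (fact m * fact n)) * norm (c m n)"
    by (simp add: norm_mult norm_divide norm_power)
  also have "\<dots> \<le> (R ^ m * R' ^ n / (fact m * fact n)) * K ^ (m + n + 1)"
    using assms order_trans[OF norm_ge_zero assms(2)] order_trans[OF norm_ge_zero assms(3)]
    by (intro mult_mono divide_right_mono power_mono) auto
  also have "\<dots> = K * ((K * R) ^ m / fact m * ((K * R') ^ n / fact n))"
    by (simp add: power_mult_distrib power_add)
  finally show ?thesis .
qed

lemma cegf_majorant_summable:
  assumes "K \<ge> 1" "R \<ge> 0" "R' \<ge> (0::real)"
  shows "(\<lambda>(m, n). K * ((K * R) ^ m / fact m * ((K * R') ^ n / fact n)))
           summable_on (UNIV :: (nat \<times> nat) set)"
  using summable_on_cmult_right[OF double_exp_summable[of "K * R" "K * R'"], of K] assms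
  by (simp add: case_prod_unfold)

lemma cegf_has_sum:
  assumes "geom_bounded (\<lambda>m n. norm (c m n))"
  shows "((\<lambda>(m, n). x ^ m * y ^ n / (fact m * fact n) * c m n) has_sum cegf c x y) UNIV"
proof -
  obtain K :: real where K: "K \<ge> 1" "\<And>m n. norm (c m n) \<le> K ^ (m + n + 1)"
    using assms unfolding geom_bounded_def by auto
  have "(\<lambda>p. norm (case p of (m, n) \<Rightarrow> x ^ m * y ^ n / (fact m * fact n) * c m n)) summable_on UNIV"
    by (rule Infinite_Sum.abs_summable_on_comparison_test'[OF cegf_majorant_summable[OF K(1), of "norm x" "norm y"]])
       (use cegf_term_le[of c _ _ K x _ y] K in \<open>auto simp del: times_divide_eq_left times_divide_eq_right\<close>)
  hence "(\<lambda>(m, n). x ^ m * y ^ n / (fact m * fact n) * c m n) summable_on UNIV"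
    by (rule Infinite_Sum.abs_summable_summable)
  thus ?thesis unfolding cegf_def by simp
qed

text \<open>
  The series of termwise derivatives in \<open>x\<close>. The terms with \<open>m = 0\<close> vanish, whatever the value of
  \<open>m - 1\<close>, and the others are reindexed by \<open>m = Suc m'\<close>.
\<close>

lemma cegf_shift_left_has_sum:
  assumes "geom_bounded (\<lambda>m n. norm (c m n))"
  shows "((\<lambda>(m, n). of_nat m * x ^ (m - 1) * y ^ n / (fact m * fact n) * c m n)
            has_sum cegf (\<lambda>m n. c (Suc m) n) x y) UNIV" (is "(?f has_sum _) _")
proof -
  have "(?f has_sum cegf (\<lambda>m n. c (Suc m) n) x y) ((\<lambda>(m, n). (Suc m, n)) ` UNIV)"
  proof (subst has_sum_reindex)
    show "inj (\<lambda>(m, n). (Suc m, n :: nat))" by (auto simp: inj_on_def)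
    have eq: "?f \<circ> (\<lambda>(m, n). (Suc m, n)) = (\<lambda>(m, n). x ^ m * y ^ n / (fact m * fact n) * c (Suc m) n)"
      by (auto simp: fun_eq_iff field_simps simp del: of_nat_Suc)
    show "(?f \<circ> (\<lambda>(m, n). (Suc m, n)) has_sum cegf (\<lambda>m n. c (Suc m) n) x y) UNIV"
      unfolding eq by (rule cegf_has_sum[OF geom_bounded_Suc(1)[OF assms]])
  qed
  moreover have "?f p = 0" if "p \<notin> (\<lambda>(m, n). (Suc m, n :: nat)) ` UNIV" for p
  proof -
    obtain m n where p: "p = (m, n)" by force
    have "m = 0" using that unfolding p by (cases m) (auto simp: image_iff)
    thus ?thesis by (simp add: p)
  qed
  ultimately show ?thesis
    by (subst has_sum_cong_neutral[of _ UNIV _ ?f]) auto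
qed

lemma cegf_swap: "cegf c x y = cegf (\<lambda>m n. c n m) y x"
proof -
  have "cegf c x y = infsum (\<lambda>(m, n). x ^ m * y ^ n / (fact m * fact n) * c m n) (prod.swap ` UNIV)"
    unfolding cegf_def by simp
  also have "\<dots> = cegf (\<lambda>m n. c n m) y x"
    unfolding cegf_def by (subst infsum_reindex) (auto simp: o_def case_prod_unfold mult_ac)
  finally show ?thesis .
qed

lemma cegf_shift_right_has_sum:
  assumes "geom_bounded (\<lambda>m n. norm (c m n))"
  shows "((\<lambda>(m, n). of_nat n * x ^ m * y ^ (n - 1) / (fact m * fact n) * c m n)
            has_sum cegf (\<lambda>m n. c m (Suc n)) x y) UNIV" (is "(?f has_sum _) _")
proof -
  from cegf_shift_left_has_sum[OF geom_bounded_swap[OF assms], of y x]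
  have "(?f \<circ> prod.swap has_sum cegf (\<lambda>m n. c m (Suc n)) x y) UNIV"
    by (subst cegf_swap) (simp add: o_def case_prod_unfold mult_ac)
  thus ?thesis by (subst (asm) has_sum_reindex[symmetric]) auto
qed

text \<open>
  The Weierstrass test gives uniform convergence of \<open>\<Sum> c(m,n) u\<^sup>m v\<^sup>n / (m! n!)\<close> on a closed disc,
  since \<open>u\<close> and \<open>v\<close> are bounded there. A uniform limit of holomorphic functions may be differentiated
  termwise, and the differentiated series splits into the two shifted ones. Working along a curve
  \<open>(u, v)\<close> keeps everything within one complex variable.
\<close>

lemma cegf_chain_rule:
  assumes c: "geom_bounded (\<lambda>m n. norm (c m n))" and S: "open S" "z \<in> S"
    and u: "\<And>w. w \<in> S \<Longrightarrow> (u has_field_derivative u' w) (at w)"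
    and v: "\<And>w. w \<in> S \<Longrightarrow> (v has_field_derivative v' w) (at w)"
  shows "((\<lambda>w. cegf c (u w) (v w)) has_field_derivative
           cegf (\<lambda>m n. c (Suc m) n) (u z) (v z) * u' z
         + cegf (\<lambda>m n. c m (Suc n)) (u z) (v z) * v' z) (at z)"
proof -
  obtain K :: real where K: "K \<ge> 1" "\<And>m n. norm (c m n) \<le> K ^ (m + n + 1)"
    using c unfolding geom_bounded_def by auto
  \<comment> \<open>a closed disc in the domain, on which the two inner functions are bounded\<close>
  obtain e where e: "e > 0" "cball z e \<subseteq> S" using S open_contains_cball by blast
  have "continuous_on (cball z e) u" "continuous_on (cball z e) v"
    using u v e by (auto intro!: DERIV_continuous_on intro: has_field_derivative_at_within)
  hence "bounded (u ` cball z e)" "bounded (v ` cball z e)"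
    by (auto intro!: compact_imp_bounded[OF compact_continuous_image])
  then obtain R R' where "\<forall>a\<in>u ` cball z e. norm a \<le> R" "\<forall>a\<in>v ` cball z e. norm a \<le> R'"
    unfolding bounded_iff by blast
  hence R: "\<And>w. w \<in> cball z e \<Longrightarrow> norm (u w) \<le> R" "\<And>w. w \<in> cball z e \<Longrightarrow> norm (v w) \<le> R'"
    by blast+
  have R0: "R \<ge> 0" "R' \<ge> 0"
    using R[of z] e order_trans[OF norm_ge_zero, of "u z" R] order_trans[OF norm_ge_zero, of "v z" R'] by simp_all
  define f where "f = (\<lambda>(m, n) w. u w ^ m * v w ^ n / (fact m * fact n) * c m n)"
  define f' where "f' = (\<lambda>(m, n) w.
     (of_nat m * u w ^ (m - 1) * v w ^ n / (fact m * fact n) * c m n) * u' w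
   + (of_nat n * u w ^ m * v w ^ (n - 1) / (fact m * fact n) * c m n) * v' w)"
  have f': "(f p has_field_derivative f' p w) (at w)" if "w \<in> S" for p w
    unfolding f_def f'_def using u[OF that] v[OF that]
    by (cases p) (auto intro!: derivative_eq_intros simp: field_simps)
  have lim: "uniform_limit (cball z e) (\<lambda>X w. \<Sum>p\<in>X. f p w) (\<lambda>w. \<Sum>\<^sub>\<infinity>p. f p w)
               (finite_subsets_at_top UNIV)"
  proof (rule Weierstrass_m_test_general)
    show "norm (f p w) \<le> (\<lambda>(m, n). K * ((K * R) ^ m / fact m * ((K * R') ^ n / fact n))) p"
      if "w \<in> cball z e" for p w
      unfolding f_def case_prod_unfold by (rule cegf_term_le[OF K(2) R(1)[OF that] R(2)[OF that] K(1)])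
  qed (rule cegf_majorant_summable[OF K(1) R0])
  have cegf_f: "(\<Sum>\<^sub>\<infinity>p. f p w) = cegf c (u w) (v w)" for w
    unfolding cegf_def f_def by (simp add: case_prod_unfold)
  have "\<forall>\<^sub>F X in finite_subsets_at_top UNIV.
      continuous_on (cball z e) (\<lambda>w. \<Sum>p\<in>X. f p w) \<and>
      (\<forall>w\<in>ball z e. ((\<lambda>w. \<Sum>p\<in>X. f p w) has_field_derivative (\<Sum>p\<in>X. f' p w)) (at w))"
  proof (intro always_eventually allI conjI ballI)
    fix X
    show "continuous_on (cball z e) (\<lambda>w. \<Sum>p\<in>X. f p w)"
      using e by (intro continuous_on_sum DERIV_continuous_on[OF has_field_derivative_at_within[OF f']]) auto
    show "((\<lambda>w. \<Sum>p\<in>X. f p w) has_field_derivative (\<Sum>p\<in>X. f' p w)) (at w)"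
      if "w \<in> ball z e" for w
      using that e by (intro DERIV_sum f') auto
  qed
  from has_complex_derivative_uniform_limit[OF this lim _ e(1)]
  obtain g' where g': "\<And>w. w \<in> ball z e \<Longrightarrow>
      ((\<lambda>w. \<Sum>\<^sub>\<infinity>p. f p w) has_field_derivative g' w) (at w) \<and>
      ((\<lambda>X. \<Sum>p\<in>X. f' p w) \<longlongrightarrow> g' w) (finite_subsets_at_top UNIV)"
    by auto
  have "((\<lambda>p. f' p z) has_sum g' z) UNIV"
    using g'[of z] e unfolding has_sum_def by (auto simp: comp_def)
  moreover have "((\<lambda>p. f' p z) has_sum (cegf (\<lambda>m n. c (Suc m) n) (u z) (v z) * u' z
         + cegf (\<lambda>m n. c m (Suc n)) (u z) (v z) * v' z)) UNIV"
    unfolding f'_def case_prod_unfold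
    using has_sum_add[OF has_sum_cmult_left[OF cegf_shift_left_has_sum[OF c], of "u z" "v z" "u' z"]
      has_sum_cmult_left[OF cegf_shift_right_has_sum[OF c], of "u z" "v z" "v' z"]]
    by (simp add: case_prod_unfold)
  ultimately have "g' z = cegf (\<lambda>m n. c (Suc m) n) (u z) (v z) * u' z
         + cegf (\<lambda>m n. c m (Suc n)) (u z) (v z) * v' z" by (rule has_sum_unique)
  thus ?thesis using g'[of z] e unfolding cegf_f by auto
qed




section \<open>Matrix algebra and an entrywise norm\<close>

lemma mat_scale_nth [simp]: "(c *k M) $ i $ j = c * M $ i $ j"
  by (simp add: mat_scale_def)

lemma mat_scale_mult_left: "(c *k M) ** N = c *k (M ** N)"
  by (simp add: vec_eq_iff matrix_matrix_mult_def sum_distrib_left mult_ac)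

lemma mat_scale_mult_right: "M ** (c *k N) = c *k (M ** N)"
  by (simp add: vec_eq_iff matrix_matrix_mult_def sum_distrib_left mult_ac)

lemma mat_scale_scale [simp]: "c *k (d *k M) = (c * d) *k M"
  by (simp add: vec_eq_iff mult_ac)

lemma mat_scale_one [simp]: "1 *k M = M"
  by (simp add: vec_eq_iff)

lemma mat_scale_zero [simp]: "0 *k M = 0" "c *k 0 = 0"
  by (simp_all add: vec_eq_iff)

lemma mat_scale_add_right: "c *k (M + N) = c *k M + c *k N"
  by (simp add: vec_eq_iff algebra_simps)

lemma mat_scale_add_left: "(c + d) *k M = c *k M + d *k M"
  by (simp add: vec_eq_iff algebra_simps)

lemma mat_scale_minus_left: "(- c) *k M = - (c *k M)"
  by (simp add: vec_eq_iff)

lemma mat_eq_scale: "mat c = c *k mat 1"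
  by (simp add: vec_eq_iff mat_def)

lemma mat_mult_left: "mat c ** M = c *k M"
  by (subst mat_eq_scale) (simp add: mat_scale_mult_left)

lemma mat_mult_right: "M ** mat c = c *k M"
  by (subst mat_eq_scale) (simp add: mat_scale_mult_right)

lemma matrix_add_rdistrib: "(M + N) ** P = M ** P + N ** P"
  by (simp add: vec_eq_iff matrix_matrix_mult_def sum.distrib algebra_simps)

lemma matrix_mult_uminus_right: "M ** (- N) = - (M ** (N :: complex^'d^'d))"
  by (simp add: vec_eq_iff matrix_matrix_mult_def sum_negf)

lemma mat_add: "mat (a + b) = mat a + (mat b :: complex^'d^'d)"
  by (simp add: vec_eq_iff mat_def)

lemma mat_minus: "mat (- a) = - (mat a :: complex^'d^'d)"
  by (simp add: vec_eq_iff mat_def)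

text \<open>
  The entrywise \<open>l\<^sup>1\<close> norm is submultiplicative and dominates each entry; these are the two properties
  through which bounds on matrix products reach the scalar series.
\<close>

definition mnorm :: "complex^'d^'d \<Rightarrow> real" where
  "mnorm M = (\<Sum>i\<in>UNIV. \<Sum>j\<in>UNIV. norm (M $ i $ j))"

lemma mnorm_nonneg: "mnorm M \<ge> 0"
  unfolding mnorm_def by (intro sum_nonneg) auto

lemma norm_entry_le_mnorm: "norm (M $ i $ j) \<le> mnorm M"
proof -
  have "norm (M $ i $ j) \<le> (\<Sum>j\<in>UNIV. norm (M $ i $ j))"
    by (rule member_le_sum) auto
  also have "\<dots> \<le> mnorm M" unfolding mnorm_def
    by (rule member_le_sum[of i UNIV "\<lambda>i. \<Sum>j\<in>UNIV. norm (M $ i $ j)"]) (auto intro: sum_nonneg)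
  finally show ?thesis .
qed

lemma mnorm_add: "mnorm (M + N) \<le> mnorm M + mnorm N"
  unfolding mnorm_def sum.distrib[symmetric] by (intro sum_mono) (simp add: norm_triangle_ineq)

lemma mnorm_uminus: "mnorm (- M) = mnorm M"
  by (simp add: mnorm_def)

lemma mnorm_scale: "mnorm (c *k M) = norm c * mnorm M"
  unfolding mnorm_def by (simp add: norm_mult sum_distrib_left)

lemma mnorm_mat_of_nat: "mnorm (mat (of_nat k) :: complex^'d^'d) = of_nat k * mnorm (mat 1 :: complex^'d^'d)"
  by (subst mat_eq_scale) (simp add: mnorm_scale)

lemma mnorm_mult: "mnorm (M ** N) \<le> mnorm M * mnorm N"
proof -
  have "mnorm (M ** N) \<le> (\<Sum>i\<in>UNIV. \<Sum>j\<in>UNIV. \<Sum>k\<in>UNIV. norm (M $ i $ k) * norm (N $ k $ j))"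
    unfolding mnorm_def matrix_matrix_mult_def
    by (intro sum_mono) (simp add: norm_mult[symmetric] sum_norm_le)
  also have "\<dots> = (\<Sum>i\<in>UNIV. \<Sum>k\<in>UNIV. norm (M $ i $ k) * (\<Sum>j\<in>UNIV. norm (N $ k $ j)))"
    by (rule sum.cong[OF refl], subst sum.swap) (simp add: sum_distrib_left)
  also have "\<dots> \<le> (\<Sum>i\<in>UNIV. \<Sum>k\<in>UNIV. norm (M $ i $ k) * mnorm N)"
  proof (intro sum_mono mult_left_mono)
    show "(\<Sum>j\<in>UNIV. norm (N $ k $ j)) \<le> mnorm N" for k unfolding mnorm_def
      by (rule member_le_sum[of k UNIV "\<lambda>i. \<Sum>j\<in>UNIV. norm (N $ i $ j)"]) (auto intro: sum_nonneg)
  qed auto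
  also have "\<dots> = mnorm M * mnorm N"
    unfolding mnorm_def[of M] by (simp add: sum_distrib_right)
  finally show ?thesis .
qed

section \<open>Matrix-valued generating functions\<close>

lemma geom_bounded_entry:
  "geom_bounded (\<lambda>m n. mnorm (a m n)) \<Longrightarrow> geom_bounded (\<lambda>m n. norm (a m n $ i $ j))"
  unfolding geom_bounded_def by (meson norm_entry_le_mnorm order_trans)

definition egf :: "(nat \<Rightarrow> nat \<Rightarrow> complex^'d^'d) \<Rightarrow> complex \<Rightarrow> complex \<Rightarrow> complex^'d^'d" where
  "egf a x y = (\<Sum>\<^sub>\<infinity>(m, n)\<in>UNIV. (x ^ m * y ^ n / (fact m * fact n)) *k a m n)"

lemma mat_has_sumI:
  fixes f :: "'a \<Rightarrow> complex^'d^'d"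
  assumes "\<And>i j. ((\<lambda>p. f p $ i $ j) has_sum S $ i $ j) A"
  shows "(f has_sum S) A"
  using assms unfolding has_sum_def
  by (intro vec_tendstoI) simp

text \<open>
  An infinite sum of matrices is only known to be the matrix of the entrywise sums once the latter
  converge, hence the growth hypothesis.
\<close>

lemma egf_nth:
  assumes "geom_bounded (\<lambda>m n. mnorm (a m n))"
  shows "egf a x y $ i $ j = cegf (\<lambda>m n. a m n $ i $ j) x y"
proof -
  have "((\<lambda>(m, n). (x ^ m * y ^ n / (fact m * fact n)) *k a m n) has_sum
      (\<chi> i j. cegf (\<lambda>m n. a m n $ i $ j) x y)) UNIV"
    using cegf_has_sum[OF geom_bounded_entry[OF assms]]
    by (intro mat_has_sumI) (simp add: case_prod_unfold)
  hence "egf a x y = (\<chi> i j. cegf (\<lambda>m n. a m n $ i $ j) x y)"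
    unfolding egf_def by (rule infsumI)
  thus ?thesis by simp
qed

lemma egf_has_sum:
  assumes "geom_bounded (\<lambda>m n. mnorm (a m n))"
  shows "((\<lambda>(m, n). (x ^ m * y ^ n / (fact m * fact n)) *k a m n) has_sum egf a x y) UNIV"
  using cegf_has_sum[OF geom_bounded_entry[OF assms]]
  by (intro mat_has_sumI) (simp add: case_prod_unfold egf_nth[OF assms])

lemma egf_shift_left_has_sum:
  assumes "geom_bounded (\<lambda>m n. mnorm (a m n))"
  shows "((\<lambda>(m, n). (x ^ m * y ^ n / (fact m * fact n) * of_nat m) *k a m n) has_sum
           x *k egf (\<lambda>m n. a (Suc m) n) x y) UNIV"
proof (rule mat_has_sumI)
  fix i j
  have pow: "x * (of_nat m * x ^ (m - 1)) = of_nat m * x ^ m" for m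
    by (cases m) auto
  have eq: "x * (of_nat m * x ^ (m - 1) * y ^ n / (fact m * fact n) * c)
    = x ^ m * y ^ n / (fact m * fact n) * of_nat m * c" for m n c
  proof -
    have "x * (of_nat m * x ^ (m - 1) * y ^ n / (fact m * fact n) * c)
      = (x * (of_nat m * x ^ (m - 1))) * y ^ n / (fact m * fact n) * c" by simp
    thus ?thesis unfolding pow by simp
  qed
  show "((\<lambda>p. (case p of (m, n) \<Rightarrow> (x ^ m * y ^ n / (fact m * fact n) * of_nat m) *k a m n) $ i $ j)
     has_sum (x *k egf (\<lambda>m n. a (Suc m) n) x y) $ i $ j) UNIV"
    using has_sum_cmult_right[OF cegf_shift_left_has_sum[OF geom_bounded_entry[OF assms]], of x x y i j]
    by (simp only: case_prod_unfold eq egf_nth[OF geom_bounded_Suc(1)[OF assms]] mat_scale_nth)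
qed

lemma egf_shift_right_has_sum:
  assumes "geom_bounded (\<lambda>m n. mnorm (a m n))"
  shows "((\<lambda>(m, n). (x ^ m * y ^ n / (fact m * fact n) * of_nat n) *k a m n) has_sum
           y *k egf (\<lambda>m n. a m (Suc n)) x y) UNIV"
proof (rule mat_has_sumI)
  fix i j
  have pow: "y * (of_nat m * y ^ (m - 1)) = of_nat m * y ^ m" for m
    by (cases m) auto
  have eq: "y * (of_nat n * x ^ m * y ^ (n - 1) / (fact m * fact n) * c)
    = x ^ m * y ^ n / (fact m * fact n) * of_nat n * c" for m n c
  proof -
    have "y * (of_nat n * x ^ m * y ^ (n - 1) / (fact m * fact n) * c)
      = x ^ m * (y * (of_nat n * y ^ (n - 1))) / (fact m * fact n) * c" by simp
    thus ?thesis unfolding pow by (simp add: mult_ac)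
  qed
  show "((\<lambda>p. (case p of (m, n) \<Rightarrow> (x ^ m * y ^ n / (fact m * fact n) * of_nat n) *k a m n) $ i $ j)
     has_sum (y *k egf (\<lambda>m n. a m (Suc n)) x y) $ i $ j) UNIV"
    using has_sum_cmult_right[OF cegf_shift_right_has_sum[OF geom_bounded_entry[OF assms]], of y x y i j]
    by (simp only: case_prod_unfold eq egf_nth[OF geom_bounded_Suc(2)[OF assms]] mat_scale_nth)
qed

lemma bounded_linear_matrix_mult:
  fixes M N :: "complex^'d^'d"
  shows "bounded_linear (\<lambda>X. M ** X ** N)"
proof (subst linear_conv_bounded_linear[symmetric], rule linearI)
  show "M ** (r *\<^sub>R X) ** N = r *\<^sub>R (M ** X ** N)" for r X
    by (simp add: vec_eq_iff matrix_matrix_mult_def sum_distrib_left scaleR_sum_right sum_distrib_right)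
qed (simp add: matrix_add_ldistrib matrix_add_rdistrib)

lemma mult_egf_mult_has_sum:
  fixes M N :: "complex^'d^'d"
  assumes "geom_bounded (\<lambda>m n. mnorm (a m n))"
  shows "((\<lambda>(m, n). (x ^ m * y ^ n / (fact m * fact n)) *k (M ** a m n ** N))
           has_sum M ** egf a x y ** N) UNIV"
  using has_sum_bounded_linear[OF bounded_linear_matrix_mult[of M N] egf_has_sum[OF assms]]
  by (simp add: case_prod_unfold mat_scale_mult_left mat_scale_mult_right)

lemma egf_mult:
  fixes M N :: "complex^'d^'d"
  assumes "geom_bounded (\<lambda>m n. mnorm (a m n))"
  shows "egf (\<lambda>m n. M ** a m n ** N) x y = M ** egf a x y ** N"
  unfolding egf_def[of "\<lambda>m n. M ** a m n ** N"]
  by (rule infsumI[OF mult_egf_mult_has_sum[OF assms]])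

text \<open>
  The Euler operators \<open>x \<partial>/\<partial>x\<close> and \<open>y \<partial>/\<partial>y\<close> multiply the coefficients by \<open>m\<close> and \<open>n\<close>. The
  combination is tailored to the two relations in which a matrix power is differentiated together with
  the series: \<open>N = 0\<close>, \<open>p = 1\<close>, \<open>q = -1\<close> produces the weight \<open>M + (m - n)I\<close>, and \<open>M = 0\<close>, \<open>p = 1\<close>,
  \<open>q = 0\<close> produces \<open>N + mI\<close>.
\<close>

lemma egf_euler:
  assumes "geom_bounded (\<lambda>m n. mnorm (a m n))"
  shows "egf (\<lambda>m n. M ** a m n + a m n ** N + (p * of_nat m + q * of_nat n) *k a m n) x y
    = M ** egf a x y + egf a x y ** N + (p * x) *k egf (\<lambda>m n. a (Suc m) n) x y
      + (q * y) *k egf (\<lambda>m n. a m (Suc n)) x y"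
proof -
  have scale: "((\<lambda>t. c *k f t) has_sum c *k S) UNIV" if "(f has_sum S) UNIV"
    for c and f :: "nat \<times> nat \<Rightarrow> complex^'d^'d" and S
    using has_sum_bounded_linear[OF bounded_linear_matrix_mult[of "mat c" "mat 1"] that]
    by (simp add: mat_mult_left)
  have "((\<lambda>t. (case t of (m, n) \<Rightarrow> (x ^ m * y ^ n / (fact m * fact n)) *k (M ** a m n ** mat 1))
       + (case t of (m, n) \<Rightarrow> (x ^ m * y ^ n / (fact m * fact n)) *k (mat 1 ** a m n ** N))
       + p *k (case t of (m, n) \<Rightarrow> (x ^ m * y ^ n / (fact m * fact n) * of_nat m) *k a m n)
       + q *k (case t of (m, n) \<Rightarrow> (x ^ m * y ^ n / (fact m * fact n) * of_nat n) *k a m n))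
     has_sum (M ** egf a x y ** mat 1 + mat 1 ** egf a x y ** N
       + p *k (x *k egf (\<lambda>m n. a (Suc m) n) x y) + q *k (y *k egf (\<lambda>m n. a m (Suc n)) x y))) UNIV"
    by (intro has_sum_add scale mult_egf_mult_has_sum egf_shift_left_has_sum
        egf_shift_right_has_sum assms)
  also have "(\<lambda>t. (case t of (m, n) \<Rightarrow> (x ^ m * y ^ n / (fact m * fact n)) *k (M ** a m n ** mat 1))
       + (case t of (m, n) \<Rightarrow> (x ^ m * y ^ n / (fact m * fact n)) *k (mat 1 ** a m n ** N))
       + p *k (case t of (m, n) \<Rightarrow> (x ^ m * y ^ n / (fact m * fact n) * of_nat m) *k a m n)
       + q *k (case t of (m, n) \<Rightarrow> (x ^ m * y ^ n / (fact m * fact n) * of_nat n) *k a m n))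
    = (\<lambda>(m, n). (x ^ m * y ^ n / (fact m * fact n)) *k
         (M ** a m n + a m n ** N + (p * of_nat m + q * of_nat n) *k a m n))"
    by (auto simp: fun_eq_iff mat_scale_add_right mat_scale_add_left distrib_left mult_ac)
  finally show ?thesis
    unfolding egf_def[of "\<lambda>m n. M ** a m n + _ m n + _ m n"] by (simp add: infsumI)
qed

section \<open>Entrywise derivatives\<close>

definition mat_has_deriv :: "(complex \<Rightarrow> complex^'d^'d) \<Rightarrow> complex^'d^'d \<Rightarrow> complex \<Rightarrow> bool" where
  "mat_has_deriv F D z \<longleftrightarrow> (\<forall>i j. ((\<lambda>w. F w $ i $ j) has_field_derivative D $ i $ j) (at z))"

lemma mat_has_deriv_imp_mat_deriv: "mat_has_deriv F D z \<Longrightarrow> mat_deriv F z = D"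
  unfolding mat_has_deriv_def mat_deriv_def by (simp add: vec_eq_iff DERIV_imp_deriv)

lemma mat_holomorphic_onI:
  assumes "open S" "\<And>z. z \<in> S \<Longrightarrow> mat_has_deriv F (D z) z"
  shows "mat_holomorphic_on F S"
  using assms unfolding mat_holomorphic_on_def mat_has_deriv_def holomorphic_on_open[OF assms(1)]
  by blast

lemma mat_has_deriv_const: "mat_has_deriv (\<lambda>_. M) 0 z"
  unfolding mat_has_deriv_def by simp

lemma mat_has_deriv_mult:
  assumes "mat_has_deriv F F' z" "mat_has_deriv G G' z"
  shows "mat_has_deriv (\<lambda>w. F w ** G w) (F' ** G z + F z ** G') z"
  unfolding mat_has_deriv_def
proof (intro allI)
  fix i j
  have "((\<lambda>w. \<Sum>k\<in>UNIV. F w $ i $ k * G w $ k $ j) has_field_derivative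
      (\<Sum>k\<in>UNIV. F' $ i $ k * G z $ k $ j + G' $ k $ j * F z $ i $ k)) (at z)"
    using assms unfolding mat_has_deriv_def by (intro DERIV_sum DERIV_mult) auto
  thus "((\<lambda>w. (F w ** G w) $ i $ j) has_field_derivative (F' ** G z + F z ** G') $ i $ j) (at z)"
    by (simp add: matrix_matrix_mult_def sum.distrib mult_ac)
qed

lemma mat_has_deriv_scale:
  assumes "(f has_field_derivative f') (at z)" "mat_has_deriv G G' z"
  shows "mat_has_deriv (\<lambda>w. f w *k G w) (f' *k G z + f z *k G') z"
  using assms unfolding mat_has_deriv_def
  by (auto intro!: derivative_eq_intros simp: mult_ac)

lemma mat_has_deriv_cmult:
  fixes M N :: "complex^'d^'d"
  assumes "mat_has_deriv F F' z"
  shows "mat_has_deriv (\<lambda>w. M ** F w ** N) (M ** F' ** N) z"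
  using mat_has_deriv_mult[OF mat_has_deriv_mult[OF mat_has_deriv_const assms] mat_has_deriv_const,
      of M N]
  by (simp add: vec_eq_iff matrix_matrix_mult_def mat_has_deriv_def)

lemma mat_has_deriv_transform:
  assumes "mat_has_deriv F D z" "open S" "z \<in> S" "\<And>w. w \<in> S \<Longrightarrow> F w = G w"
  shows "mat_has_deriv G D z"
  using assms unfolding mat_has_deriv_def
  by (metis (no_types, lifting) has_field_derivative_transform_within_open)

lemma egf_chain_rule:
  assumes a: "geom_bounded (\<lambda>m n. mnorm (a m n))" and S: "open S" "z \<in> S"
    and u: "\<And>w. w \<in> S \<Longrightarrow> (u has_field_derivative u' w) (at w)"
    and v: "\<And>w. w \<in> S \<Longrightarrow> (v has_field_derivative v' w) (at w)"
  shows "mat_has_deriv (\<lambda>w. egf a (u w) (v w))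
           (u' z *k egf (\<lambda>m n. a (Suc m) n) (u z) (v z)
          + v' z *k egf (\<lambda>m n. a m (Suc n)) (u z) (v z)) z"
  unfolding mat_has_deriv_def
  using cegf_chain_rule[OF geom_bounded_entry[OF a] S u v]
  by (simp add: egf_nth[OF a] egf_nth[OF geom_bounded_Suc(1)[OF a]]
      egf_nth[OF geom_bounded_Suc(2)[OF a]] mult_ac)




section \<open>Matrix exponential and matrix powers\<close>

lemma mat_pow_Suc_left: "mat_pow M (Suc m) = M ** mat_pow M m"
proof (induction m)
  case (Suc m)
  have "mat_pow M (Suc (Suc m)) = (M ** mat_pow M m) ** M" using Suc.IH by simp
  also have "\<dots> = M ** mat_pow M (Suc m)" by (simp add: matrix_mul_assoc)
  finally show ?case .
qed simp

lemma mat_pow_scale: "mat_pow (x *k M) k = x ^ k *k mat_pow M k"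
  by (induction k) (simp_all add: mat_scale_mult_left mat_scale_mult_right mult_ac)

lemma mat_pow_commute: "M ** X = X ** M \<Longrightarrow> mat_pow M k ** X = X ** mat_pow M k"
proof (induction k)
  case (Suc k)
  have "mat_pow M (Suc k) ** X = mat_pow M k ** (M ** X)" by (simp add: matrix_mul_assoc)
  also have "\<dots> = (mat_pow M k ** X) ** M" unfolding Suc.prems by (simp add: matrix_mul_assoc)
  also have "\<dots> = X ** mat_pow M (Suc k)" unfolding Suc.IH[OF Suc.prems] by (simp add: matrix_mul_assoc)
  finally show ?case .
qed simp

lemma geom_bounded_mat_pow: "geom_bounded (\<lambda>m n. mnorm (mat_pow M m))"
proof -
  define K where "K = max 1 (max (mnorm M) (mnorm (mat 1 :: complex^'a^'a)))"
  have K: "K \<ge> 1" "mnorm M \<le> K" "mnorm (mat 1 :: complex^'a^'a) \<le> K" by (auto simp: K_def)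
  have "mnorm (mat_pow M m) \<le> K ^ (m + 1)" for m
  proof (induction m)
    case (Suc m)
    have "mnorm (mat_pow M (Suc m)) \<le> mnorm (mat_pow M m) * mnorm M" by (simp add: mnorm_mult)
    also have "\<dots> \<le> K ^ (m + 1) * K" using Suc K by (intro mult_mono) (auto simp: mnorm_nonneg)
    finally show ?case by (simp add: mult_ac)
  qed (use K in simp)
  moreover have "K ^ (m + 1) \<le> K ^ (m + n + 1)" for m n using K by (intro power_increasing) auto
  ultimately have "mnorm (mat_pow M m) \<le> K ^ (m + n + 1)" for m n by (meson order_trans)
  thus ?thesis using K unfolding geom_bounded_def by blast
qed

text \<open>
  At \<open>y = 0\<close> only the terms with \<open>n = 0\<close> survive, by the convention \<open>0\<^sup>0 = 1\<close>. The exponential thereby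
  inherits convergence and termwise differentiation.
\<close>

lemma mat_exp_eq_egf: "mat_exp (x *k M) = egf (\<lambda>m n. mat_pow M m) x 0"
proof -
  let ?f = "\<lambda>(m, n). (x ^ m * 0 ^ n / (fact m * fact n)) *k mat_pow M m"
  have inj: "inj (\<lambda>m :: nat. (m, 0 :: nat))" by (auto simp: inj_on_def)
  have "(?f has_sum egf (\<lambda>m n. mat_pow M m) x 0) (range (\<lambda>m. (m, 0)))"
    using egf_has_sum[OF geom_bounded_mat_pow, of x 0 M]
    by (subst has_sum_cong_neutral[of UNIV _ ?f ?f]) (auto simp: image_iff power_0_left)
  hence "(?f \<circ> (\<lambda>m. (m, 0)) has_sum egf (\<lambda>m n. mat_pow M m) x 0) UNIV"
    by (rule iffD1[OF has_sum_reindex[OF inj]])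
  also have "?f \<circ> (\<lambda>m. (m, 0)) = (\<lambda>k. (1 / fact k) *k mat_pow (x *k M) k)"
    by (simp add: fun_eq_iff mat_pow_scale)
  finally have "((\<lambda>k. (1 / fact k) *k mat_pow (x *k M) k) has_sum egf (\<lambda>m n. mat_pow M m) x 0) UNIV" .
  thus ?thesis unfolding mat_exp_def by (rule sums_unique[OF has_sum_imp_sums, symmetric])
qed

lemma mat_exp_zero: "mat_exp (0 *k M) = mat 1"
proof -
  have "(\<lambda>k. (1 / fact k) *k mat_pow (0 *k M) k) sums (\<Sum>k\<in>{0}. (1 / fact k) *k mat_pow (0 *k M) k)"
    by (rule sums_finite) (auto simp: mat_pow_scale vec_eq_iff power_0_left simp del: mat_scale_zero)
  thus ?thesis unfolding mat_exp_def by (simp add: sums_unique[symmetric])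
qed

lemma mat_exp_commute:
  assumes "M ** X = X ** M"
  shows "mat_exp (x *k M) ** X = X ** mat_exp (x *k M)"
proof -
  have "mat 1 ** egf (\<lambda>m n. mat_pow M m) x 0 ** X = X ** egf (\<lambda>m n. mat_pow M m) x 0 ** mat 1"
    unfolding egf_mult[OF geom_bounded_mat_pow, symmetric]
    using mat_pow_commute[OF assms] by simp
  thus ?thesis by (simp add: mat_exp_eq_egf)
qed

lemma mat_exp_has_deriv:
  assumes "open S" "z \<in> S" "\<And>w. w \<in> S \<Longrightarrow> (u has_field_derivative u' w) (at w)"
  shows "mat_has_deriv (\<lambda>w. mat_exp (u w *k M)) (u' z *k (M ** mat_exp (u z *k M))) z"
proof -
  have "mat_has_deriv (\<lambda>w. egf (\<lambda>m n. mat_pow M m) (u w) 0)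
      (u' z *k egf (\<lambda>m n. mat_pow M (Suc m)) (u z) 0) z"
    using egf_chain_rule[OF geom_bounded_mat_pow assms, of "\<lambda>_. 0" "\<lambda>_. 0"] by simp
  moreover have "egf (\<lambda>m n. mat_pow M (Suc m)) x 0 = M ** egf (\<lambda>m n. mat_pow M m) x 0" for x
    using egf_mult[OF geom_bounded_mat_pow, of M M "mat 1" x 0]
    by (simp add: mat_pow_Suc_left del: mat_pow.simps)
  ultimately show ?thesis by (simp add: mat_exp_eq_egf)
qed

lemma mat_exp_has_deriv_id:
  "mat_has_deriv (\<lambda>w. mat_exp (w *k M)) (M ** mat_exp (z *k M)) z"
  using mat_exp_has_deriv[of UNIV z "\<lambda>w. w" "\<lambda>_. 1" M] by simp

text \<open>
  For any solution \<open>G\<close> of \<open>G' = M G\<close> the product \<open>exp (-zM) G(z)\<close> has derivative zero, as \<open>M\<close> commutes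
  with \<open>exp (-zM)\<close>, and so equals \<open>G(0)\<close>. Taking \<open>G(z) = exp (zM)\<close> first shows that \<open>exp (-zM)\<close> and
  \<open>exp (zM)\<close> are inverse to each other, and then the same for \<open>H\<close> gives the claim.
\<close>

lemma mat_linear_ode_unique:
  assumes H: "\<And>z. mat_has_deriv H (M ** H z) z"
  shows "H z = mat_exp (z *k M) ** H 0"
proof -
  have const: "mat_exp (z *k (- M)) ** G z = G 0"
    if G: "\<And>z. mat_has_deriv G (M ** G z) z" for G z
  proof -
    have comm: "mat_exp (w *k (- M)) ** M = M ** mat_exp (w *k (- M))" for w
      by (rule mat_exp_commute) (simp add: vec_eq_iff matrix_matrix_mult_def sum_negf)
    have "mat_has_deriv (\<lambda>w. mat_exp (w *k (- M)) ** G w) 0 w" for w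
    proof -
      have "(- M) ** mat_exp (w *k (- M)) ** G w + mat_exp (w *k (- M)) ** (M ** G w) = 0"
        unfolding matrix_mul_assoc comm
        by (simp add: vec_eq_iff matrix_matrix_mult_def sum_negf)
      thus ?thesis using mat_has_deriv_mult[OF mat_exp_has_deriv_id[of "- M" w] G[of w]] by simp
    qed
    hence "\<exists>c. \<forall>w\<in>UNIV. (mat_exp (w *k (- M)) ** G w) $ i $ j = c" for i j
      unfolding mat_has_deriv_def by (intro has_field_derivative_zero_constant) simp_all
    hence "(mat_exp (z *k (- M)) ** G z) $ i $ j = (mat_exp (0 *k (- M)) ** G 0) $ i $ j" for i j
    proof -
      obtain c where "\<And>w. (mat_exp (w *k (- M)) ** G w) $ i $ j = c"
        using \<open>\<And>i j. \<exists>c. \<forall>w\<in>UNIV. (mat_exp (w *k (- M)) ** G w) $ i $ j = c\<close>[of i j] by auto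
      thus ?thesis by (simp only:)
    qed
    thus ?thesis unfolding mat_exp_zero by (simp add: vec_eq_iff)
  qed
  have "mat_exp (z *k (- M)) ** mat_exp (z *k M) = mat 1"
    using const[of "\<lambda>w. mat_exp (w *k M)" z] mat_exp_has_deriv_id[of M] mat_exp_zero[of M] by simp
  hence "mat_exp (z *k M) ** mat_exp (z *k (- M)) = mat 1" by (simp add: matrix_left_right_inverse)
  hence "H z = mat_exp (z *k M) ** (mat_exp (z *k (- M)) ** H z)" by (simp add: matrix_mul_assoc)
  thus ?thesis unfolding const[OF H] .
qed

text \<open>
  The function \<open>exp (-cz) exp (z(M + cI))\<close> solves \<open>H' = M H\<close> with \<open>H(0) = I\<close>.
\<close>

lemma mat_exp_add_mat: "mat_exp (z *k (M + mat c)) = exp (c * z) *k mat_exp (z *k M)"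
proof -
  let ?H = "\<lambda>w. exp (- c * w) *k mat_exp (w *k (M + mat c))"
  have "mat_has_deriv ?H (M ** ?H w) w" for w
  proof -
    have "mat_has_deriv ?H (- c * exp (- c * w) *k mat_exp (w *k (M + mat c))
       + exp (- c * w) *k ((M + mat c) ** mat_exp (w *k (M + mat c)))) w"
      by (rule mat_has_deriv_scale) (auto intro!: derivative_eq_intros mat_exp_has_deriv_id)
    thus ?thesis
      by (simp add: matrix_add_rdistrib mat_mult_left mat_scale_add_right mat_scale_mult_right
          mat_scale_minus_left mult_ac)
  qed
  from mat_linear_ode_unique[of ?H, OF this, of z]
  have "exp (c * z) *k ?H z = exp (c * z) *k mat_exp (z *k M)"
    using mat_exp_zero[of "M + mat c"] by simp
  thus ?thesis by (simp add: exp_minus)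
qed

lemma mat_powr_has_deriv:
  assumes "z \<notin> \<real>\<^sub>\<le>\<^sub>0"
  shows "mat_has_deriv (\<lambda>w. mat_powr w M) (inverse z *k (M ** mat_powr z M)) z"
  unfolding mat_powr_def using assms
  by (intro mat_exp_has_deriv[of "- \<real>\<^sub>\<le>\<^sub>0" _ Ln inverse]) (auto intro: has_field_derivative_Ln)

lemma mat_powr_plus_one: "z \<noteq> 0 \<Longrightarrow> mat_powr z (M + mat 1) = z *k mat_powr z M"
  unfolding mat_powr_def by (simp add: mat_exp_add_mat)

lemma mat_powr_commute: "M ** X = X ** M \<Longrightarrow> mat_powr z M ** X = X ** mat_powr z M"
  unfolding mat_powr_def by (rule mat_exp_commute)




section \<open>Inverses and Pochhammer symbols of matrices\<close>

lemma matrix_inv_left_right: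
  assumes "invertible M"
  shows "matrix_inv M ** M = mat 1" "M ** matrix_inv M = mat 1"
  using assms unfolding invertible_def matrix_inv_def by (metis (mono_tags, lifting) someI_ex)+

lemma matrix_inv_unique:
  fixes M N :: "complex^'d^'d"
  assumes "M ** N = mat 1"
  shows "matrix_inv M = N"
proof -
  have M: "invertible M" using assms by (auto simp: invertible_right_inverse)
  have "matrix_inv M = matrix_inv M ** (M ** N)" by (simp add: assms)
  also have "\<dots> = N" by (simp add: matrix_mul_assoc matrix_inv_left_right[OF M])
  finally show ?thesis .
qed

lemma matrix_inv_mult:
  fixes M N :: "complex^'d^'d"
  assumes "invertible M" "invertible N"
  shows "matrix_inv (M ** N) = matrix_inv N ** matrix_inv M"
proof (rule matrix_inv_unique)
  have "M ** N ** (matrix_inv N ** matrix_inv M) = M ** (N ** matrix_inv N) ** matrix_inv M"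
    by (simp add: matrix_mul_assoc)
  thus "M ** N ** (matrix_inv N ** matrix_inv M) = mat 1"
    by (simp add: matrix_inv_left_right assms)
qed

lemma matrix_inv_uminus:
  fixes M :: "complex^'d^'d"
  assumes "invertible M"
  shows "matrix_inv (- M) = - matrix_inv M" "invertible (- M)"
proof -
  have "(- M) ** (- matrix_inv M) = M ** matrix_inv M"
    by (simp add: vec_eq_iff matrix_matrix_mult_def)
  hence *: "(- M) ** (- matrix_inv M) = mat 1" by (simp add: matrix_inv_left_right assms)
  thus "matrix_inv (- M) = - matrix_inv M" by (rule matrix_inv_unique)
  show "invertible (- M)" using * by (auto simp: invertible_right_inverse)
qed

lemma matrix_inv_commute:
  fixes M X :: "complex^'d^'d"
  assumes "invertible M" "M ** X = X ** M"
  shows "matrix_inv M ** X = X ** matrix_inv M"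
proof -
  have "matrix_inv M ** X = matrix_inv M ** (X ** M) ** matrix_inv M"
    by (simp add: matrix_mul_assoc[symmetric] matrix_inv_left_right assms(1))
  also have "\<dots> = X ** matrix_inv M"
    unfolding assms(2)[symmetric] by (simp add: matrix_mul_assoc matrix_inv_left_right assms(1))
  finally show ?thesis .
qed

lemma matrix_cancel_right:
  fixes M X Y :: "complex^'d^'d"
  assumes "invertible M" "X ** M = Y ** M"
  shows "X = Y"
proof -
  have "X ** M ** matrix_inv M = Y ** M ** matrix_inv M" using assms by simp
  thus ?thesis by (simp add: matrix_mul_assoc[symmetric] matrix_inv_left_right assms(1))
qed

lemma add_mat_commute:
  fixes M X :: "complex^'d^'d"
  assumes "M ** X = X ** M"
  shows "(M + mat c) ** X = X ** (M + mat c)"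
  using assms by (simp add: matrix_add_rdistrib matrix_add_ldistrib mat_mult_left mat_mult_right)

lemma mult_commute_left:
  assumes "M ** X = X ** M" "N ** X = X ** N"
  shows "(M ** N) ** X = X ** (M ** N)"
proof -
  have "(M ** N) ** X = (M ** X) ** N" using assms(2) by (simp add: matrix_mul_assoc[symmetric])
  thus ?thesis unfolding assms(1) by (simp add: matrix_mul_assoc)
qed

lemma mat_poch_commute: "M ** X = X ** M \<Longrightarrow> mat_poch M n ** X = X ** mat_poch M n"
  by (induction n) (simp_all add: mult_commute_left add_mat_commute)

lemma mat_poch_Suc_left: "mat_poch M (Suc n) = M ** mat_poch (M + mat 1) n"
proof (induction n)
  case (Suc n)
  have "M + mat (of_nat (Suc n)) = M + mat 1 + mat (of_nat n)" by (simp add: mat_add add.assoc)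
  moreover have "mat_poch M (Suc (Suc n)) = M ** mat_poch (M + mat 1) n ** (M + mat (of_nat (Suc n)))"
    unfolding Suc.IH[symmetric] by simp
  ultimately show ?case by (simp only: mat_poch.simps matrix_mul_assoc)
qed simp

lemma invertible_mat_poch:
  "(\<And>k. k < n \<Longrightarrow> invertible (M + mat (of_nat k))) \<Longrightarrow> invertible (mat_poch M n)"
proof (induction n)
  case 0
  have "mat 1 ** mat 1 = (mat 1 :: complex^'a^'a)" by simp
  thus ?case unfolding invertible_def by auto
qed (simp add: invertible_mult)

text \<open>
  Equivalently, all \<open>(M)\<^sub>n\<close> are invertible. The series for \<open>A\<close> and \<open>C\<close> is meaningful precisely when this
  holds for \<open>C\<close> and for \<open>I - A\<close>, because the symbols \<open>(A)\<^bsub>-n\<^esub>\<close> contain the inverses of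
  \<open>(I - A)\<^sub>n\<close>.
\<close>

definition poch_regular :: "complex^'d^'d \<Rightarrow> bool" where
  "poch_regular M \<longleftrightarrow> (\<forall>k::nat. invertible (M + mat (of_nat k)))"

lemma poch_regular_add_one: "poch_regular M \<Longrightarrow> poch_regular (M + mat 1)"
  unfolding poch_regular_def
  by (metis add.assoc mat_add of_nat_Suc)

lemma poch_regular_minus_one:
  assumes "poch_regular M" "invertible (M - mat 1)"
  shows "poch_regular (M - mat 1)"
  unfolding poch_regular_def
proof
  fix k :: nat
  show "invertible (M - mat 1 + mat (of_nat k))"
  proof (cases k)
    case (Suc j)
    hence eq: "M - mat 1 + mat (of_nat k) = M + mat (of_nat j)" by (simp add: mat_add)
    show ?thesis unfolding eq using assms(1) by (simp add: poch_regular_def)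
  qed (use assms in simp)
qed

text \<open>
  Passing from \<open>A\<close> to \<open>A + I\<close> adds the factor \<open>-A\<close> to the symbols \<open>(I - A)\<^sub>n\<close>; so regularity
  is preserved exactly if \<open>A\<close> is invertible.
\<close>

lemma poch_regular_raise:
  fixes A :: "complex^'d^'d"
  assumes "poch_regular (mat 1 - A)" "invertible A"
  shows "poch_regular (mat 1 - (A + mat 1))"
proof -
  have eq: "mat 1 - (A + mat 1) = mat 1 - A - mat 1" by simp
  show ?thesis unfolding eq
    by (rule poch_regular_minus_one[OF assms(1)]) (simp add: matrix_inv_uminus assms(2))
qed

lemma poch_regular_lower:
  fixes A :: "complex^'d^'d"
  assumes "poch_regular (mat 1 - A)"
  shows "poch_regular (mat 1 - (A - mat 1))" "invertible (A - mat 1)"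
proof -
  have eq: "mat 1 - (A - mat 1) = mat 1 - A + mat 1" by simp
  show "poch_regular (mat 1 - (A - mat 1))" unfolding eq by (rule poch_regular_add_one[OF assms])
  have "invertible (- (mat 1 - A))"
    using assms unfolding poch_regular_def
    by (intro matrix_inv_uminus(2)) (metis add.right_neutral mat_0 of_nat_0)
  thus "invertible (A - mat 1)" by simp
qed

lemma poch_regular_plus_of_nat: "poch_regular C \<Longrightarrow> poch_regular (C + mat (of_nat k))"
proof (induction k)
  case (Suc k)
  have eq: "C + mat (of_nat (Suc k)) = C + mat (of_nat k) + mat 1" by (simp add: mat_add add_ac)
  show ?case unfolding eq by (rule poch_regular_add_one[OF Suc.IH[OF Suc.prems]])
qed simp

lemma poch_regular_minus_of_nat:
  "poch_regular C \<Longrightarrow> (\<And>j. 1 \<le> j \<Longrightarrow> j \<le> k \<Longrightarrow> invertible (C - mat (of_nat j)))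
    \<Longrightarrow> poch_regular (C - mat (of_nat k))"
proof (induction k)
  case (Suc k)
  have eq: "C - mat (of_nat (Suc k)) = C - mat (of_nat k) - mat 1" by (simp add: mat_add diff_diff_eq add_ac)
  show ?case unfolding eq
  proof (rule poch_regular_minus_one)
    show "invertible (C - mat (of_nat k) - mat 1)"
      unfolding eq[symmetric] by (rule Suc.prems(2)) auto
  qed (use Suc in auto)
qed simp

lemma poch_regular_raise_of_nat:
  fixes A :: "complex^'d^'d"
  assumes "poch_regular (mat 1 - A)" "\<And>j. j < k \<Longrightarrow> invertible (A + mat (of_nat j))"
  shows "poch_regular (mat 1 - (A + mat (of_nat k)))"
  using assms(2)
proof (induction k)
  case (Suc k)
  have eq: "A + mat (of_nat (Suc k)) = A + mat (of_nat k) + mat 1" by (simp add: mat_add add_ac)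
  show ?case unfolding eq by (rule poch_regular_raise) (use Suc in auto)
qed (use assms(1) in simp)

lemma poch_regular_lower_of_nat:
  fixes A :: "complex^'d^'d"
  assumes "poch_regular (mat 1 - A)"
  shows "poch_regular (mat 1 - (A - mat (of_nat k)))"
proof -
  have eq: "mat 1 - (A - mat (of_nat k)) = mat 1 - A + mat (of_nat k)" by simp
  show ?thesis unfolding eq by (rule poch_regular_plus_of_nat[OF assms])
qed

lemma poch_regular_invertible: "poch_regular M \<Longrightarrow> invertible (mat_poch M n)"
  by (intro invertible_mat_poch) (simp add: poch_regular_def)

lemma mat_poch_int_of_nat: "mat_poch_int A (int n) = mat_poch A n"
  by (simp add: mat_poch_int_def)

lemma mat_poch_int_minus_of_nat:
  "mat_poch_int A (- int n) = (- 1) ^ n *k matrix_inv (mat_poch (mat 1 - A) n)"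
  by (cases "n = 0") (simp_all add: mat_poch_int_def matrix_inv_unique)

lemma one_minus_commute:
  fixes A X :: "complex^'d^'d"
  assumes "A ** X = X ** A" shows "(mat 1 - A) ** X = X ** (mat 1 - A)"
proof -
  have "(mat 1 - A) ** X = X - A ** X"
    using matrix_add_rdistrib[of "mat 1 - A" A X] by (simp add: eq_diff_eq)
  moreover have "X ** (mat 1 - A) = X - X ** A"
    using matrix_add_ldistrib[of X "mat 1 - A" A] by (simp add: eq_diff_eq)
  ultimately show ?thesis using assms by simp
qed

lemma mat_poch_int_commute:
  fixes A X :: "complex^'d^'d"
  assumes "poch_regular (mat 1 - A)" "A ** X = X ** A"
  shows "mat_poch_int A k ** X = X ** mat_poch_int A k"
proof (cases k rule: int_cases2)
  case (nonneg n)
  thus ?thesis by (simp add: mat_poch_int_of_nat mat_poch_commute assms)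
next
  case (nonpos n)
  thus ?thesis
    using assms by (simp add: mat_poch_int_minus_of_nat mat_scale_mult_left mat_scale_mult_right
      matrix_inv_commute poch_regular_invertible mat_poch_commute one_minus_commute)
qed

text \<open>
  For \<open>k = -(n + 1)\<close> the matrix \<open>A + kI\<close> is the negative of the last factor of \<open>(I - A)\<^bsub>n+1\<^esub>\<close>, so
  it cancels that factor in the inverse and one of the signs.
\<close>

lemma mat_poch_int_step:
  fixes A :: "complex^'d^'d"
  assumes "poch_regular (mat 1 - A)"
  shows "mat_poch_int A (k + 1) = mat_poch_int A k ** (A + mat (of_int k))"
proof (cases "k \<ge> 0")
  case True
  then obtain n where k: "k = int n" by (metis nonneg_int_cases)
  have "k + 1 = int (Suc n)" by (simp add: k)
  thus ?thesis by (simp only: k mat_poch_int_of_nat) simp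
next
  case False
  then obtain n where k: "k = - int (Suc n)" by (metis negD not_le)
  define Q where "Q = mat_poch (mat 1 - A) n"
  define D where "D = A + mat (of_int k)"
  have D: "mat 1 - A + mat (of_nat n) = - D"
    unfolding D_def k by (auto simp: vec_eq_iff mat_def)
  have invD: "invertible D"
  proof -
    have "invertible (- D)" using assms unfolding poch_regular_def D[symmetric] by blast
    from matrix_inv_uminus(2)[OF this] show ?thesis by simp
  qed
  have invQ: "invertible Q" unfolding Q_def by (rule poch_regular_invertible[OF assms])
  have QD: "Q ** D = D ** Q" unfolding Q_def D_def
    by (intro mat_poch_commute one_minus_commute) (simp add: matrix_add_ldistrib matrix_add_rdistrib mat_mult_left mat_mult_right)
  have "mat_poch (mat 1 - A) (Suc n) = - (Q ** D)"
    unfolding mat_poch.simps D Q_def[symmetric] by (simp add: vec_eq_iff matrix_matrix_mult_def sum_negf)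
  hence "matrix_inv (mat_poch (mat 1 - A) (Suc n)) = - (matrix_inv D ** matrix_inv Q)"
    by (simp add: matrix_inv_uminus invertible_mult matrix_inv_mult invD invQ)
  moreover have "(matrix_inv D ** matrix_inv Q) ** D = matrix_inv Q"
  proof -
    have "(matrix_inv D ** matrix_inv Q) ** D = matrix_inv D ** (D ** matrix_inv Q)"
      using matrix_inv_commute[OF invQ QD] by (simp add: matrix_mul_assoc[symmetric])
    thus ?thesis by (simp add: matrix_mul_assoc matrix_inv_left_right invD)
  qed
  ultimately have "matrix_inv (mat_poch (mat 1 - A) (Suc n)) ** D = - matrix_inv Q"
    by (simp add: vec_eq_iff matrix_matrix_mult_def sum_negf)
  hence "mat_poch_int A (- int (Suc n)) ** D = (- 1) ^ n *k matrix_inv Q"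
    unfolding mat_poch_int_minus_of_nat by (simp add: mat_scale_mult_left vec_eq_iff)
  moreover have "k + 1 = - int n" by (simp add: k)
  ultimately show ?thesis unfolding D_def[symmetric] by (simp only: mat_poch_int_minus_of_nat Q_def k)
qed

text \<open>
  Induction on \<open>k\<close> in both directions from \<open>(A)\<^sub>1 = A\<close>, each step by the recurrence at the other end.
  Going down requires cancelling \<open>A + iI\<close> with \<open>i \<le> 0\<close>: for \<open>i = 0\<close> this is the invertibility of \<open>A\<close>,
  for \<open>i < 0\<close> it is part of the regularity of \<open>I - A\<close>.
\<close>

lemma mat_poch_int_Suc_left:
  fixes A :: "complex^'d^'d"
  assumes A: "poch_regular (mat 1 - A)" and inv: "invertible A"
  shows "mat_poch_int A (k + 1) = A ** mat_poch_int (A + mat 1) k"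
proof -
  note reg = poch_regular_raise[OF A inv]
  have shift: "A + mat 1 + mat (of_int i) = A + mat (of_int (i + 1))" for i
    by (simp add: mat_add algebra_simps)
  show ?thesis
  proof (induction k rule: int_induct[where k = 0])
    case base
    show ?case using mat_poch_int_of_nat[of A 1] mat_poch_int_of_nat[of "A + mat 1" 0] by simp
  next
    case (step1 i)
    have "mat_poch_int A (i + 1 + 1) = mat_poch_int A (i + 1) ** (A + mat (of_int (i + 1)))"
      by (rule mat_poch_int_step[OF A])
    also have "\<dots> = A ** mat_poch_int (A + mat 1) (i + 1)"
      unfolding step1 mat_poch_int_step[OF reg] shift by (simp only: matrix_mul_assoc)
    finally show ?case .
  next
    case (step2 i)
    have inv': "invertible (A + mat (of_int i))"
    proof (cases "i = 0")
      case False
      then obtain n where n: "i = - int (Suc n)" using step2 by (metis int_cases2 negD le_less not_le)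
      have eq: "A + mat (of_int i) = - (mat 1 - A + mat (of_nat n))"
        unfolding n by (auto simp: vec_eq_iff mat_def)
      show ?thesis unfolding eq
        by (rule matrix_inv_uminus(2)) (use A in \<open>simp add: poch_regular_def\<close>)
    qed (simp add: inv)
    have "mat_poch_int A i ** (A + mat (of_int i)) = mat_poch_int A (i + 1)"
      by (simp add: mat_poch_int_step[OF A])
    also have "\<dots> = A ** mat_poch_int (A + mat 1) (i - 1 + 1)" using step2 by simp
    also have "\<dots> = A ** mat_poch_int (A + mat 1) (i - 1) ** (A + mat (of_int i))"
      unfolding mat_poch_int_step[OF reg] shift by (simp add: matrix_mul_assoc)
    finally show ?case using matrix_cancel_right[OF inv'] by simp
  qed
qed


section \<open>Growth of the coefficients\<close>

text \<open>
  For \<open>X = (M + nI)\<^sup>-\<^sup>1\<close> the equation \<open>n X = I - M X\<close> gives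
  \<open>n \<parallel>X\<parallel> \<le> \<parallel>I\<parallel> + \<parallel>M\<parallel> \<parallel>X\<parallel>\<close>. Hence \<open>\<parallel>X\<parallel> \<le> \<parallel>I\<parallel>\<close> once \<open>n \<ge> \<parallel>M\<parallel> + 1\<close>, so \<open>\<parallel>X\<parallel>\<close> is bounded
  over all \<open>n\<close>, and inserting this bound on the right yields the decay.
\<close>

lemma mnorm_inverse_shift_bound:
  fixes M :: "complex^'d^'d"
  assumes "poch_regular M"
  obtains K where "K \<ge> 1" "\<And>n::nat. mnorm (matrix_inv (M + mat (of_nat n))) \<le> K / (real n + 1)"
proof -
  define X where "X n = matrix_inv (M + mat (of_nat n))" for n :: nat
  define c where "c = mnorm M"
  define d where "d = mnorm (mat 1 :: complex^'d^'d)"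
  have nonneg: "c \<ge> 0" "d \<ge> 0" by (simp_all add: c_def d_def mnorm_nonneg)
  have key: "real n * mnorm (X n) \<le> d + c * mnorm (X n)" for n
  proof -
    have "(M + mat (of_nat n)) ** X n = mat 1"
      using assms unfolding X_def poch_regular_def by (simp add: matrix_inv_left_right)
    hence "of_nat n *k X n = mat 1 + - (M ** X n)"
      by (simp add: matrix_add_rdistrib mat_mult_left eq_diff_eq add.commute)
    hence "mnorm (of_nat n *k X n) \<le> d + mnorm (M ** X n)"
      unfolding d_def using mnorm_add[of "mat 1" "- (M ** X n)"] by (simp add: mnorm_uminus)
    also have "mnorm (M ** X n) \<le> c * mnorm (X n)" unfolding c_def by (rule mnorm_mult)
    finally show ?thesis by (simp add: mnorm_scale)
  qed
  \<comment> \<open>beyond this index the coefficient \<open>n - c\<close> is at least one\<close>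
  define N where "N = nat \<lceil>c\<rceil> + 1"
  define B where "B = d + (\<Sum>k<N. mnorm (X k))"
  have B: "mnorm (X n) \<le> B" for n
  proof (cases "n < N")
    case True
    have "mnorm (X n) \<le> (\<Sum>k<N. mnorm (X k))"
      using True by (intro member_le_sum) (auto simp: mnorm_nonneg)
    thus ?thesis using nonneg by (simp add: B_def)
  next
    case False
    hence "real n - c \<ge> 1" unfolding N_def by linarith
    hence "1 * mnorm (X n) \<le> (real n - c) * mnorm (X n)"
      by (intro mult_right_mono mnorm_nonneg)
    also have "\<dots> \<le> d" using key[of n] by (simp add: algebra_simps)
    also have "d \<le> B" unfolding B_def by (simp add: sum_nonneg mnorm_nonneg)
    finally show ?thesis by simp
  qed
  show ?thesis
  proof (rule that)
    show "mnorm (matrix_inv (M + mat (of_nat n))) \<le> max 1 (d + (c + 1) * B) / (real n + 1)" for n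
    proof -
      have "(real n + 1) * mnorm (X n) \<le> d + (c + 1) * mnorm (X n)"
        using key[of n] by (simp add: algebra_simps)
      also have "\<dots> \<le> d + (c + 1) * B"
        using nonneg B by (intro add_left_mono mult_left_mono) auto
      also have "\<dots> \<le> max 1 (d + (c + 1) * B)" by simp
      finally show ?thesis unfolding X_def by (simp add: field_simps)
    qed
  qed simp
qed

lemma mnorm_inverse_poch_bound:
  fixes M :: "complex^'d^'d"
  assumes "poch_regular M"
  obtains K where "K \<ge> 1" "\<And>n. mnorm (matrix_inv (mat_poch M n)) \<le> K ^ (n + 1) / fact n"
proof -
  obtain L where L: "L \<ge> 1" "\<And>n::nat. mnorm (matrix_inv (M + mat (of_nat n))) \<le> L / (real n + 1)"
    using mnorm_inverse_shift_bound[OF assms] by blast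
  define K where "K = max L (mnorm (mat 1 :: complex^'d^'d))"
  have K: "K \<ge> 1" "L \<le> K" "mnorm (mat 1 :: complex^'d^'d) \<le> K" using L(1) by (auto simp: K_def)
  have "mnorm (matrix_inv (mat_poch M n)) \<le> K ^ (n + 1) / fact n" for n
  proof (induction n)
    case 0
    show ?case using K by (simp add: matrix_inv_unique)
  next
    case (Suc n)
    have inv: "invertible (M + mat (of_nat n))" using assms by (simp add: poch_regular_def)
    have "matrix_inv (mat_poch M (Suc n)) = matrix_inv (M + mat (of_nat n)) ** matrix_inv (mat_poch M n)"
      by (simp add: matrix_inv_mult poch_regular_invertible[OF assms] inv)
    hence "mnorm (matrix_inv (mat_poch M (Suc n)))
        \<le> mnorm (matrix_inv (M + mat (of_nat n))) * mnorm (matrix_inv (mat_poch M n))"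
      by (simp add: mnorm_mult)
    also have "\<dots> \<le> (K / (real n + 1)) * (K ^ (n + 1) / fact n)"
    proof (intro mult_mono Suc.IH mnorm_nonneg)
      have "L / (real n + 1) \<le> K / (real n + 1)" using K by (intro divide_right_mono) auto
      thus "mnorm (matrix_inv (M + mat (of_nat n))) \<le> K / (real n + 1)"
        using L(2)[of n] by linarith
    qed (use K in auto)
    also have "\<dots> = K ^ (Suc n + 1) / fact (Suc n)" by (simp add: field_simps)
    finally show ?case .
  qed
  thus ?thesis using that K by blast
qed

lemma mnorm_poch_bound:
  fixes M :: "complex^'d^'d"
  obtains K where "K \<ge> 1" "\<And>n. mnorm (mat_poch M n) \<le> K ^ (n + 1) * fact n"
proof -
  define d where "d = mnorm (mat 1 :: complex^'d^'d)"
  define K where "K = max 1 (max (mnorm M) d)"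
  have K: "K \<ge> 1" "mnorm M \<le> K" "d \<le> K" by (auto simp: K_def)
  have "mnorm (mat_poch M n) \<le> K ^ (n + 1) * fact n" for n
  proof (induction n)
    case 0
    show ?case using K by (simp add: d_def)
  next
    case (Suc n)
    have "mnorm (M + mat (of_nat n)) \<le> mnorm M + of_nat n * d"
      unfolding d_def using mnorm_add[of M "mat (of_nat n)"] mnorm_mat_of_nat[where 'd = 'd, of n] by simp
    also have "\<dots> \<le> K + of_nat n * K" using K by (intro add_mono mult_left_mono) auto
    finally have step: "mnorm (M + mat (of_nat n)) \<le> K * (real n + 1)" by (simp add: algebra_simps)
    have "mnorm (mat_poch M (Suc n)) \<le> mnorm (mat_poch M n) * mnorm (M + mat (of_nat n))"
      by (simp add: mnorm_mult)
    also have "\<dots> \<le> (K ^ (n + 1) * fact n) * (K * (real n + 1))"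
      using K by (intro mult_mono Suc.IH step mnorm_nonneg) auto
    also have "\<dots> = K ^ (Suc n + 1) * fact (Suc n)" by (simp add: algebra_simps)
    finally show ?case .
  qed
  thus ?thesis using that K by blast
qed

definition H5_coeff :: "complex^'d^'d \<Rightarrow> complex^'d^'d \<Rightarrow> nat \<Rightarrow> nat \<Rightarrow> complex^'d^'d" where
  "H5_coeff A C m n = mat_poch_int A (int m - int n) ** matrix_inv (mat_poch C m)"

lemma horn_H5_eq_egf: "horn_H5 A C x y = egf (H5_coeff A C) x y"
  unfolding horn_H5_def egf_def H5_coeff_def by simp

text \<open>
  The numerator costs at most a factor \<open>m!\<close>: for \<open>m \<ge> n\<close> it is of size \<open>(m - n)!\<close>, for \<open>m < n\<close> it even
  decays. The inverse of \<open>(C)\<^sub>m\<close> pays for it.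
\<close>

lemma H5_coeff_bounded:
  fixes A C :: "complex^'d^'d"
  assumes A: "poch_regular (mat 1 - A)" and C: "poch_regular C"
  shows "geom_bounded (\<lambda>m n. mnorm (H5_coeff A C m n))"
proof -
  obtain K1 where K1: "K1 \<ge> 1" "\<And>n. mnorm (mat_poch A n) \<le> K1 ^ (n + 1) * fact n"
    using mnorm_poch_bound[of A] by blast
  obtain K2 where K2: "K2 \<ge> 1"
    "\<And>n. mnorm (matrix_inv (mat_poch (mat 1 - A) n)) \<le> K2 ^ (n + 1) / fact n"
    using mnorm_inverse_poch_bound[OF A] by blast
  obtain K3 where K3: "K3 \<ge> 1" "\<And>n. mnorm (matrix_inv (mat_poch C n)) \<le> K3 ^ (n + 1) / fact n"
    using mnorm_inverse_poch_bound[OF C] by blast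
  define K where "K = max K1 K2"
  have K: "K \<ge> 1" "K1 \<le> K" "K2 \<le> K" using K1 by (auto simp: K_def)
  have num: "mnorm (mat_poch_int A (int m - int n)) \<le> K ^ (m + n + 1) * fact m" for m n
  proof (cases "n \<le> m")
    case True
    hence "mat_poch_int A (int m - int n) = mat_poch A (m - n)"
      using mat_poch_int_of_nat[of A "m - n"] by (simp add: of_nat_diff)
    hence "mnorm (mat_poch_int A (int m - int n)) \<le> K1 ^ (m - n + 1) * fact (m - n)"
      using K1(2) by simp
    also have "\<dots> \<le> K ^ (m + n + 1) * fact m"
    proof (intro mult_mono fact_mono)
      have "K1 ^ (m - n + 1) \<le> K ^ (m - n + 1)" using K K1 by (intro power_mono) auto
      also have "\<dots> \<le> K ^ (m + n + 1)" using K by (intro power_increasing) auto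
      finally show "K1 ^ (m - n + 1) \<le> K ^ (m + n + 1)" .
    qed (use K in auto)
    finally show ?thesis .
  next
    case False
    hence eq: "int m - int n = - int (n - m)" by simp
    have "mnorm (mat_poch_int A (int m - int n)) \<le> K2 ^ (n - m + 1) / fact (n - m)"
      unfolding eq mat_poch_int_minus_of_nat mnorm_scale using K2(2) by (simp add: norm_power)
    also have "\<dots> \<le> K2 ^ (n - m + 1) / 1"
      using K2(1) by (intro divide_left_mono) auto
    also have "\<dots> \<le> K ^ (n - m + 1)" using K K2 by (simp add: power_mono del: power_Suc)
    also have "\<dots> \<le> K ^ (m + n + 1)" using K by (intro power_increasing) auto
    also have "\<dots> \<le> K ^ (m + n + 1) * fact m"
      using K mult_left_mono[of 1 "fact m" "K ^ (m + n + 1)"] by (simp add: fact_ge_1)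
    finally show ?thesis .
  qed
  have "mnorm (H5_coeff A C m n) \<le> (K * K3) ^ (m + n + 1)" for m n
  proof -
    have "mnorm (H5_coeff A C m n) \<le>
        mnorm (mat_poch_int A (int m - int n)) * mnorm (matrix_inv (mat_poch C m))"
      unfolding H5_coeff_def by (rule mnorm_mult)
    also have "\<dots> \<le> (K ^ (m + n + 1) * fact m) * (K3 ^ (m + 1) / fact m)"
      using K by (intro mult_mono num K3 mnorm_nonneg) auto
    also have "\<dots> = K ^ (m + n + 1) * K3 ^ (m + 1)" by simp
    also have "\<dots> \<le> K ^ (m + n + 1) * K3 ^ (m + n + 1)"
      using K K3 by (intro mult_left_mono power_increasing) auto
    finally show ?thesis by (simp only: power_mult_distrib)
  qed
  moreover have "K * K3 \<ge> 1" using K K3 mult_mono[of 1 K 1 K3] by simp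
  ultimately show ?thesis unfolding geom_bounded_def by blast
qed




section \<open>Contiguous relations between the coefficients\<close>

lemma H5_coeff_Suc_left:
  fixes A C :: "complex^'d^'d"
  assumes "poch_regular (mat 1 - A)" "poch_regular C" "invertible A"
  shows "H5_coeff A C (Suc m) n = A ** H5_coeff (A + mat 1) (C + mat 1) m n ** matrix_inv C"
proof -
  have C: "invertible C" using assms(2) unfolding poch_regular_def by (metis add.right_neutral mat_0 of_nat_0)
  have "int (Suc m) - int n = int m - int n + 1" by simp
  hence "mat_poch_int A (int (Suc m) - int n) = A ** mat_poch_int (A + mat 1) (int m - int n)"
    by (simp only: mat_poch_int_Suc_left[OF assms(1,3)])
  moreover have "matrix_inv (mat_poch C (Suc m)) = matrix_inv (mat_poch (C + mat 1) m) ** matrix_inv C"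
    unfolding mat_poch_Suc_left
    by (intro matrix_inv_mult C poch_regular_invertible poch_regular_add_one assms)
  ultimately show ?thesis unfolding H5_coeff_def by (simp only: matrix_mul_assoc)
qed

lemma H5_coeff_Suc_right:
  fixes A C :: "complex^'d^'d"
  assumes "poch_regular (mat 1 - A)"
  shows "H5_coeff A C m (Suc n) = matrix_inv (A - mat 1) ** H5_coeff (A - mat 1) C m n"
proof -
  note A' = poch_regular_lower[OF assms]
  have "int m - int n = int m - int (Suc n) + 1" by simp
  hence "mat_poch_int (A - mat 1) (int m - int n) = (A - mat 1) ** mat_poch_int A (int m - int (Suc n))"
    using mat_poch_int_Suc_left[OF A', of "int m - int (Suc n)"] by simp
  hence "mat_poch_int A (int m - int (Suc n))
      = matrix_inv (A - mat 1) ** mat_poch_int (A - mat 1) (int m - int n)"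
    by (simp add: matrix_mul_assoc matrix_inv_left_right A')
  thus ?thesis unfolding H5_coeff_def by (simp only: matrix_mul_assoc)
qed

lemma H5_coeff_raise:
  fixes A C :: "complex^'d^'d"
  assumes A: "poch_regular (mat 1 - A)" "invertible A"
  shows "A ** H5_coeff A C m n + (of_nat m - of_nat n) *k H5_coeff A C m n
    = A ** H5_coeff (A + mat 1) C m n"
proof -
  let ?k = "int m - int n"
  have "A ** mat_poch_int A ?k + (of_nat m - of_nat n) *k mat_poch_int A ?k
      = mat_poch_int A ?k ** (A + mat (of_int ?k))"
    by (simp add: matrix_add_ldistrib mat_mult_right mat_poch_int_commute[OF A(1)])
  also have "\<dots> = A ** mat_poch_int (A + mat 1) ?k"
    by (simp only: mat_poch_int_step[OF A(1), symmetric] mat_poch_int_Suc_left[OF A])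
  finally have eq: "A ** mat_poch_int A ?k + (of_nat m - of_nat n) *k mat_poch_int A ?k
    = A ** mat_poch_int (A + mat 1) ?k" .
  have "A ** H5_coeff A C m n + (of_nat m - of_nat n) *k H5_coeff A C m n
    = (A ** mat_poch_int A ?k + (of_nat m - of_nat n) *k mat_poch_int A ?k) ** matrix_inv (mat_poch C m)"
    unfolding H5_coeff_def by (simp add: matrix_add_rdistrib mat_scale_mult_left matrix_mul_assoc)
  thus ?thesis unfolding eq H5_coeff_def by (simp add: matrix_mul_assoc)
qed

text \<open>
  Both \<open>(C - I)\<^sub>m (C + (m - 1)I)\<close> and \<open>(C - I)(C)\<^sub>m\<close> equal \<open>(C - I)\<^bsub>m+1\<^esub>\<close>, and all these
  matrices commute. Multiplication by the inverses of \<open>(C - I)\<^sub>m\<close> and \<open>(C)\<^sub>m\<close> gives the claim.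
\<close>

lemma H5_coeff_lower_C:
  fixes A C :: "complex^'d^'d"
  assumes C: "poch_regular C" "invertible (C - mat 1)"
  shows "H5_coeff A C m n ** (C - mat 1) + of_nat m *k H5_coeff A C m n
    = H5_coeff A (C - mat 1) m n ** (C - mat 1)"
proof -
  define D where "D = C - mat 1"
  define P where "P = mat_poch D m"
  define Q where "Q = mat_poch C m"
  have C_eq: "C = D + mat 1" by (simp add: D_def)
  have invP: "invertible P" unfolding P_def D_def
    by (rule poch_regular_invertible[OF poch_regular_minus_one[OF C]])
  have invQ: "invertible Q" unfolding Q_def by (rule poch_regular_invertible[OF C(1)])
  have CD: "C ** D = D ** C" unfolding C_eq by (rule add_mat_commute) simp
  have QD: "Q ** D = D ** Q" unfolding Q_def using CD by (rule mat_poch_commute)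
  have PQ: "P ** Q = Q ** P" unfolding P_def
    by (rule mat_poch_commute) (rule QD[symmetric])
  have PE: "P ** (D + mat (of_nat m)) = D ** Q"
    using mat_poch_Suc_left[of D m] unfolding P_def Q_def C_eq by simp
  have PP: "matrix_inv P ** P = mat 1" and QQ: "matrix_inv Q ** Q = mat 1"
    using matrix_inv_left_right invP invQ by blast+
  have "matrix_inv Q ** (D + mat (of_nat m)) = matrix_inv P ** (P ** matrix_inv Q) ** (D + mat (of_nat m))"
    by (simp add: matrix_mul_assoc PP)
  also have "\<dots> = matrix_inv P ** matrix_inv Q ** (P ** (D + mat (of_nat m)))"
    unfolding matrix_inv_commute[OF invQ PQ[symmetric], symmetric] by (simp only: matrix_mul_assoc)
  also have "\<dots> = matrix_inv P ** (matrix_inv Q ** Q) ** D"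
    unfolding PE QD[symmetric] by (simp only: matrix_mul_assoc)
  finally have "matrix_inv Q ** (D + mat (of_nat m)) = matrix_inv P ** D" by (simp add: QQ)
  moreover have "H5_coeff A C m n ** D + of_nat m *k H5_coeff A C m n
     = mat_poch_int A (int m - int n) ** (matrix_inv Q ** (D + mat (of_nat m)))"
    unfolding H5_coeff_def Q_def by (simp add: matrix_add_ldistrib mat_mult_right mat_scale_mult_right matrix_mul_assoc)
  ultimately show ?thesis
    unfolding D_def[symmetric] H5_coeff_def P_def by (simp add: matrix_mul_assoc)
qed

section \<open>Derivatives of first order\<close>

lemma horn_H5_has_deriv_x:
  fixes A C :: "complex^'d^'d"
  assumes "poch_regular (mat 1 - A)" "poch_regular C" "invertible A"
  shows "mat_has_deriv (\<lambda>z. horn_H5 A C z y)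
           (A ** horn_H5 (A + mat 1) (C + mat 1) x y ** matrix_inv C) x"
proof -
  have b: "geom_bounded (\<lambda>m n. mnorm (H5_coeff (A + mat 1) (C + mat 1) m n))"
    by (intro H5_coeff_bounded poch_regular_raise poch_regular_add_one assms)
  have "mat_has_deriv (\<lambda>z. egf (H5_coeff A C) z y) (egf (\<lambda>m n. H5_coeff A C (Suc m) n) x y) x"
    using egf_chain_rule[OF H5_coeff_bounded[OF assms(1,2)], of UNIV x "\<lambda>z. z" "\<lambda>_. 1" "\<lambda>_. y" "\<lambda>_. 0"]
    by simp
  thus ?thesis
    unfolding horn_H5_eq_egf H5_coeff_Suc_left[OF assms] egf_mult[OF b] .
qed

lemma horn_H5_has_deriv_y:
  fixes A C :: "complex^'d^'d"
  assumes "poch_regular (mat 1 - A)" "poch_regular C"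
  shows "mat_has_deriv (\<lambda>w. horn_H5 A C x w) (matrix_inv (A - mat 1) ** horn_H5 (A - mat 1) C x y) y"
proof -
  have b: "geom_bounded (\<lambda>m n. mnorm (H5_coeff (A - mat 1) C m n))"
    by (intro H5_coeff_bounded poch_regular_lower assms)
  have "mat_has_deriv (\<lambda>w. egf (H5_coeff A C) x w) (egf (\<lambda>m n. H5_coeff A C m (Suc n)) x y) y"
    using egf_chain_rule[OF H5_coeff_bounded[OF assms], of UNIV y "\<lambda>_. x" "\<lambda>_. 0" "\<lambda>z. z" "\<lambda>_. 1"]
    by simp
  thus ?thesis
    unfolding horn_H5_eq_egf H5_coeff_Suc_right[OF assms(1)]
    using egf_mult[OF b, of "matrix_inv (A - mat 1)" "mat 1"] by simp
qed

lemma open_slit_plane: "open (- \<real>\<^sub>\<le>\<^sub>0 :: complex set)"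
  by (simp add: open_Compl)

text \<open>
  With \<open>w = y / x\<close>, the product and chain rules turn \<open>x\<^sup>2 d/dx\<close> of \<open>x\<^sup>A H(x, w)\<close> into
  \<open>x\<^bsup>A+I\<^esup> (A + x \<partial>/\<partial>x - w \<partial>/\<partial>w) H\<close>, and the operator in brackets weights the coefficients
  by \<open>A + (m - n)I\<close>, which raises \<open>A\<close>. The derivative itself is left unnamed because only its multiple
  by \<open>x\<^sup>2\<close> has a closed form.
\<close>

lemma horn_H5_powr_has_deriv_quotient:
  fixes A C :: "complex^'d^'d"
  assumes A: "poch_regular (mat 1 - A)" "invertible A" and C: "poch_regular C" and x: "x \<notin> \<real>\<^sub>\<le>\<^sub>0"
  obtains D where "mat_has_deriv (\<lambda>z. mat_powr z A ** horn_H5 A C z (y / z)) D x"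
    "x\<^sup>2 *k D = A ** (mat_powr x (A + mat 1) ** horn_H5 (A + mat 1) C x (y / x))"
proof -
  have x0: "x \<noteq> 0" using x by auto
  note b = H5_coeff_bounded[OF A(1) C]
  have b': "geom_bounded (\<lambda>m n. mnorm (H5_coeff (A + mat 1) C m n))"
    by (intro H5_coeff_bounded poch_regular_raise A C)
  let ?H = "egf (H5_coeff A C) x (y / x)"
  let ?Hx = "egf (\<lambda>m n. H5_coeff A C (Suc m) n) x (y / x)"
  let ?Hy = "egf (\<lambda>m n. H5_coeff A C m (Suc n)) x (y / x)"
  let ?P = "mat_powr x A"
  have dH: "mat_has_deriv (\<lambda>z. egf (H5_coeff A C) z (y / z)) (1 *k ?Hx + (- (y / x\<^sup>2)) *k ?Hy) x"
  proof (rule egf_chain_rule[OF b open_slit_plane, where u = "\<lambda>z. z" and v = "\<lambda>z. y / z"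
        and u' = "\<lambda>_. 1" and v' = "\<lambda>z. - (y / z\<^sup>2)"])
    show "((\<lambda>z. y / z) has_field_derivative - (y / w\<^sup>2)) (at w)" if "w \<in> - \<real>\<^sub>\<le>\<^sub>0" for w
      using that by (auto intro!: derivative_eq_intros simp: power2_eq_square)
  qed (use x in auto)
  \<comment> \<open>the only interchange needed: a matrix power commutes with its own exponent\<close>
  have A_P: "A ** ?P = ?P ** A" using mat_powr_commute[of A A] by simp
  have euler: "A ** ?H + x *k ?Hx + (- (y / x)) *k ?Hy = A ** egf (H5_coeff (A + mat 1) C) x (y / x)"
    using egf_euler[OF b, of A 0 1 "-1" x "y / x"] egf_mult[OF b', of A "mat 1" x "y / x"]
    by (simp add: H5_coeff_raise[OF A])
  have xx: "x * x * inverse x = x" using x0 by simp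
  have "x\<^sup>2 *k (inverse x *k (A ** ?P) ** ?H + ?P ** (1 *k ?Hx + (- (y / x\<^sup>2)) *k ?Hy))
      = x *k (?P ** (A ** ?H + x *k ?Hx + (- (y / x)) *k ?Hy))"
    unfolding A_P using x0
    by (simp add: mat_scale_mult_left mat_scale_mult_right mat_scale_add_right matrix_add_ldistrib
        matrix_mul_assoc power2_eq_square add.assoc xx)
  also have "\<dots> = A ** (mat_powr x (A + mat 1) ** horn_H5 (A + mat 1) C x (y / x))"
    unfolding euler mat_powr_plus_one[OF x0] horn_H5_eq_egf
    by (simp add: matrix_mul_assoc A_P mat_scale_mult_left mat_scale_mult_right)
  finally show ?thesis
    using that[OF mat_has_deriv_mult[OF mat_powr_has_deriv[OF x] dH, folded horn_H5_eq_egf]]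
    by (simp only: horn_H5_eq_egf)
qed

text \<open>
  Here the derivative is \<open>H (C - I + x \<partial>/\<partial>x) x\<^bsup>C-2I\<^esup>\<close> with the operator acting to the left; it
  weights the coefficients by \<open>C + (m - 1)I\<close> on the right, which lowers \<open>C\<close>.
\<close>

lemma horn_H5_powr_has_deriv_x:
  fixes A C :: "complex^'d^'d"
  assumes A: "poch_regular (mat 1 - A)" and C: "poch_regular C" "invertible (C - mat 1)"
    and x: "x \<notin> \<real>\<^sub>\<le>\<^sub>0"
  shows "mat_has_deriv (\<lambda>z. horn_H5 A C z y ** mat_powr z (C - mat 1))
     (horn_H5 A (C - mat 1) x y ** mat_powr x (C - mat 1 - mat 1) ** (C - mat 1)) x"
proof -
  have x0: "x \<noteq> 0" using x by auto
  note b = H5_coeff_bounded[OF A C(1)]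
  have b': "geom_bounded (\<lambda>m n. mnorm (H5_coeff A (C - mat 1) m n))"
    by (intro H5_coeff_bounded poch_regular_minus_one A C)
  let ?D = "C - mat 1"
  let ?H = "egf (H5_coeff A C) x y" and ?Hx = "egf (\<lambda>m n. H5_coeff A C (Suc m) n) x y"
  let ?P = "mat_powr x (C - mat 1 - mat 1)"
  have dH: "mat_has_deriv (\<lambda>z. egf (H5_coeff A C) z y) ?Hx x"
    using egf_chain_rule[OF b, of UNIV x "\<lambda>z. z" "\<lambda>_. 1" "\<lambda>_. y" "\<lambda>_. 0"] by simp
  have P: "mat_powr x ?D = x *k ?P" using mat_powr_plus_one[OF x0, of "?D - mat 1"] by simp
  have "(?D - mat 1) ** ?D = ?D ** (?D - mat 1)"
    using add_mat_commute[of ?D ?D "- 1"] by (simp add: mat_minus)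
  hence D_P: "?D ** ?P = ?P ** ?D" using mat_powr_commute[of "?D - mat 1" ?D] by simp
  have euler: "?H ** ?D + x *k ?Hx = egf (H5_coeff A (C - mat 1)) x y ** ?D"
    using egf_euler[OF b, of 0 ?D 1 0 x y] egf_mult[OF b', of "mat 1" ?D x y]
    by (simp add: H5_coeff_lower_C[OF C])
  have "?Hx ** mat_powr x ?D + ?H ** (inverse x *k (?D ** mat_powr x ?D))
      = (?H ** ?D + x *k ?Hx) ** ?P"
    unfolding P using x0
    by (simp add: mat_scale_mult_left mat_scale_mult_right matrix_add_rdistrib matrix_mul_assoc add.commute)
  also have "\<dots> = horn_H5 A (C - mat 1) x y ** ?P ** ?D"
    unfolding euler horn_H5_eq_egf using D_P by (simp add: matrix_mul_assoc[symmetric])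
  finally show ?thesis
    using mat_has_deriv_mult[OF dH mat_powr_has_deriv[OF x, of ?D]] unfolding horn_H5_eq_egf by simp
qed

section \<open>Derivatives of higher order\<close>

text \<open>
  A closed form known only on an open set may still be differentiated there, as the derivative depends
  only on the values near the point; so the principal branch of the logarithm causes no trouble off the
  cut. The weight \<open>g\<close> covers both \<open>d/dz\<close> and \<open>z\<^sup>2 d/dz\<close>.
\<close>

lemma iterated_weighted_mat_deriv:
  assumes S: "open S"
    and step: "\<And>k z. k < r \<Longrightarrow> z \<in> S \<Longrightarrow> \<exists>D. mat_has_deriv (G k) D z \<and> g z *k D = G (Suc k) z"
    and F: "\<And>z. z \<in> S \<Longrightarrow> F z = G 0 z" and z: "z \<in> S"
  shows "((\<lambda>F z. g z *k mat_deriv F z) ^^ r) F z = G r z"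
proof -
  have "\<forall>z\<in>S. ((\<lambda>F z. g z *k mat_deriv F z) ^^ k) F z = G k z" if "k \<le> r" for k
    using that
  proof (induction k)
    case (Suc k)
    show ?case
    proof
      fix z assume z: "z \<in> S"
      obtain D where D: "mat_has_deriv (G k) D z" "g z *k D = G (Suc k) z"
        using step[of k z] Suc.prems z by auto
      have "mat_has_deriv (((\<lambda>F z. g z *k mat_deriv F z) ^^ k) F) D z"
        by (rule mat_has_deriv_transform[OF D(1) S z]) (use Suc in auto)
      thus "((\<lambda>F z. g z *k mat_deriv F z) ^^ Suc k) F z = G (Suc k) z"
        using D(2) by (simp add: mat_has_deriv_imp_mat_deriv)
    qed
  qed (use F in auto)
  thus ?thesis using z by blast
qed

lemma iterated_mat_deriv:
  assumes "open S"
    and "\<And>k z. k < r \<Longrightarrow> z \<in> S \<Longrightarrow> mat_has_deriv (G k) (G (Suc k) z) z"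
    and "\<And>z. z \<in> S \<Longrightarrow> F z = G 0 z" and "z \<in> S"
  shows "(mat_deriv ^^ r) F z = G r z"
  using iterated_weighted_mat_deriv[of S r G "\<lambda>_. 1" F z] assms by auto

text \<open>
  Each step splits off \<open>A + kI\<close> on the left and the inverse of \<open>C + kI\<close> on the right, next to the series
  and hence inside the factors split off before: the former extends \<open>(A)\<^sub>k\<close> at its right end, the latter
  extends the inverse of \<open>(C)\<^sub>k\<close> at its left end.
\<close>

lemma horn_H5_iterated_deriv_x:
  fixes A C :: "complex^'d^'d"
  assumes A: "poch_regular (mat 1 - A)" and C: "poch_regular C"
    and inv: "\<And>k. k < r \<Longrightarrow> invertible (A + mat (of_nat k))"
  shows "(mat_deriv ^^ r) (\<lambda>z. horn_H5 A C z y) x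
    = mat_poch A r ** horn_H5 (A + mat (of_nat r)) (C + mat (of_nat r)) x y ** matrix_inv (mat_poch C r)"
proof (rule iterated_mat_deriv[where S = UNIV and G = "\<lambda>k z. mat_poch A k
    ** horn_H5 (A + mat (of_nat k)) (C + mat (of_nat k)) z y ** matrix_inv (mat_poch C k)"])
  fix k z assume k: "k < r"
  let ?A = "A + mat (of_nat k)" and ?C = "C + mat (of_nat k)"
  have regA: "poch_regular (mat 1 - ?A)" by (rule poch_regular_raise_of_nat[OF A]) (use inv k in auto)
  have regC: "poch_regular ?C" by (rule poch_regular_plus_of_nat[OF C])
  have S: "M + mat (of_nat (Suc k)) = M + mat (of_nat k) + mat 1" for M :: "complex^'d^'d"
    by (simp add: mat_add add_ac)
  have invC: "matrix_inv (mat_poch C (Suc k)) = matrix_inv ?C ** matrix_inv (mat_poch C k)"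
    unfolding mat_poch.simps using C
    by (intro matrix_inv_mult poch_regular_invertible) (auto simp: poch_regular_def)
  have "mat_has_deriv (\<lambda>z. mat_poch A k ** horn_H5 ?A ?C z y ** matrix_inv (mat_poch C k))
      (mat_poch A k ** (?A ** horn_H5 (?A + mat 1) (?C + mat 1) z y ** matrix_inv ?C)
        ** matrix_inv (mat_poch C k)) z"
    by (intro mat_has_deriv_cmult horn_H5_has_deriv_x regA regC inv k)
  thus "mat_has_deriv (\<lambda>z. mat_poch A k ** horn_H5 ?A ?C z y ** matrix_inv (mat_poch C k))
      (mat_poch A (Suc k) ** horn_H5 (A + mat (of_nat (Suc k))) (C + mat (of_nat (Suc k))) z y
        ** matrix_inv (mat_poch C (Suc k))) z"
    unfolding S invC by (simp add: matrix_mul_assoc)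
qed (auto simp: matrix_inv_unique)

text \<open>
  The accumulated factor is \<open>(A)\<^bsub>-k\<^esub>\<close>: each step multiplies it by the inverse of
  \<open>A - (k + 1)I\<close>, which is the recurrence of the integer Pochhammer symbol read downwards. The sign in
  the formula comes from rewriting \<open>(A)\<^bsub>-r\<^esub>\<close> as an inverse of \<open>(I - A)\<^sub>r\<close>.
\<close>

lemma horn_H5_iterated_deriv_y:
  fixes A C :: "complex^'d^'d"
  assumes A: "poch_regular (mat 1 - A)" and C: "poch_regular C"
  shows "(mat_deriv ^^ r) (\<lambda>w. horn_H5 A C x w) y
    = (- 1) ^ r *k (matrix_inv (mat_poch (mat 1 - A) r) ** horn_H5 (A - mat (of_nat r)) C x y)"
proof -
  have "(mat_deriv ^^ r) (\<lambda>w. horn_H5 A C x w) y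
      = mat_poch_int A (- int r) ** horn_H5 (A - mat (of_nat r)) C x y"
  proof (rule iterated_mat_deriv[where S = UNIV and G = "\<lambda>k w. mat_poch_int A (- int k)
      ** horn_H5 (A - mat (of_nat k)) C x w"])
    fix k w
    let ?A = "A - mat (of_nat k)"
    have S: "A - mat (of_nat (Suc k)) = ?A - mat 1" by (simp add: mat_add diff_diff_eq add_ac)
    note reg = poch_regular_lower_of_nat[OF A, of k]
    have "- int k = - int (Suc k) + 1" by simp
    hence "mat_poch_int A (- int k) = mat_poch_int A (- int (Suc k)) ** (A + mat (of_int (- int (Suc k))))"
      by (simp only: mat_poch_int_step[OF A])
    also have "A + mat (of_int (- int (Suc k))) = ?A - mat 1"
      by (auto simp: vec_eq_iff mat_def)
    finally have "mat_poch_int A (- int (Suc k)) = mat_poch_int A (- int k) ** matrix_inv (?A - mat 1)"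
      by (simp add: matrix_mul_assoc[symmetric] matrix_inv_left_right poch_regular_lower[OF reg])
    moreover have "mat_has_deriv (\<lambda>w. mat_poch_int A (- int k) ** horn_H5 ?A C x w ** mat 1)
       (mat_poch_int A (- int k) ** (matrix_inv (?A - mat 1) ** horn_H5 (?A - mat 1) C x w) ** mat 1) w"
      by (intro mat_has_deriv_cmult horn_H5_has_deriv_y reg C)
    ultimately show "mat_has_deriv (\<lambda>w. mat_poch_int A (- int k) ** horn_H5 ?A C x w)
       (mat_poch_int A (- int (Suc k)) ** horn_H5 (A - mat (of_nat (Suc k))) C x w) w"
      unfolding S by (simp only: matrix_mul_rid matrix_mul_assoc)
  qed (auto simp: mat_poch_int_def)
  thus ?thesis by (simp add: mat_poch_int_minus_of_nat mat_scale_mult_left)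
qed

lemma horn_H5_iterated_deriv_quotient:
  fixes A C :: "complex^'d^'d"
  assumes A: "poch_regular (mat 1 - A)" and C: "poch_regular C"
    and inv: "\<And>k. k < r \<Longrightarrow> invertible (A + mat (of_nat k))" and x: "x \<notin> \<real>\<^sub>\<le>\<^sub>0"
  shows "((\<lambda>F z. z\<^sup>2 *k mat_deriv F z) ^^ r) (\<lambda>z. mat_powr z A ** horn_H5 A C z (y / z)) x
    = mat_powr x (A + mat (of_nat r)) ** mat_poch A r ** horn_H5 (A + mat (of_nat r)) C x (y / x)"
proof -
  let ?G = "\<lambda>k z. mat_poch A k ** (mat_powr z (A + mat (of_nat k))
               ** horn_H5 (A + mat (of_nat k)) C z (y / z))"
  have "((\<lambda>F z. z\<^sup>2 *k mat_deriv F z) ^^ r) (\<lambda>z. mat_powr z A ** horn_H5 A C z (y / z)) x = ?G r x"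
  proof (rule iterated_weighted_mat_deriv[OF open_slit_plane, where G = ?G])
    fix k and z :: complex assume k: "k < r" and z: "z \<in> - \<real>\<^sub>\<le>\<^sub>0"
    let ?A = "A + mat (of_nat k)"
    have reg: "poch_regular (mat 1 - ?A)" by (rule poch_regular_raise_of_nat[OF A]) (use inv k in auto)
    have S: "A + mat (of_nat (Suc k)) = ?A + mat 1" by (simp add: mat_add add_ac)
    obtain D where D: "mat_has_deriv (\<lambda>z. mat_powr z ?A ** horn_H5 ?A C z (y / z)) D z"
      "z\<^sup>2 *k D = ?A ** (mat_powr z (?A + mat 1) ** horn_H5 (?A + mat 1) C z (y / z))"
      using horn_H5_powr_has_deriv_quotient[OF reg inv[OF k] C, of z y] z by auto
    have "mat_has_deriv (?G k) (mat_poch A k ** D) z"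
      using mat_has_deriv_cmult[OF D(1), of "mat_poch A k" "mat 1"] by simp
    moreover have "z\<^sup>2 *k (mat_poch A k ** D) = ?G (Suc k) z"
      unfolding mat_scale_mult_right[symmetric] D(2) S by (simp add: matrix_mul_assoc)
    ultimately show "\<exists>D. mat_has_deriv (?G k) D z \<and> z\<^sup>2 *k D = ?G (Suc k) z" by blast
  qed (use x in auto)
  moreover have "mat_powr x (A + mat (of_nat r)) ** mat_poch A r
      = mat_poch A r ** mat_powr x (A + mat (of_nat r))"
    by (intro mat_powr_commute add_mat_commute) (simp add: mat_poch_commute)
  ultimately show ?thesis by (simp add: matrix_mul_assoc)
qed

text \<open>
  The accumulated factor is \<open>(C - I)(C - 2I) \<dots> (C - kI) = (-1)\<^sup>k (I - C)\<^sub>k\<close>.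
\<close>

lemma horn_H5_iterated_deriv_powr:
  fixes A C :: "complex^'d^'d"
  assumes A: "poch_regular (mat 1 - A)" and C: "poch_regular C"
    and inv: "\<And>k. 1 \<le> k \<Longrightarrow> k \<le> r \<Longrightarrow> invertible (C - mat (of_nat k))" and x: "x \<notin> \<real>\<^sub>\<le>\<^sub>0"
  shows "(mat_deriv ^^ r) (\<lambda>z. horn_H5 A C z y ** mat_powr z (C - mat 1)) x
    = (- 1) ^ r *k (horn_H5 A (C - mat (of_nat r)) x y
        ** mat_powr x (C - mat (of_nat (r + 1))) ** mat_poch (mat 1 - C) r)"
proof -
  let ?P = "\<lambda>k. (- 1) ^ k *k mat_poch (mat 1 - C) k"
  let ?G = "\<lambda>k z. horn_H5 A (C - mat (of_nat k)) z y ** mat_powr z (C - mat (of_nat k) - mat 1) ** ?P k"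
  have "(mat_deriv ^^ r) (\<lambda>z. horn_H5 A C z y ** mat_powr z (C - mat 1)) x = ?G r x"
  proof (rule iterated_mat_deriv[OF open_slit_plane, where G = ?G])
    fix k and z :: complex assume k: "k < r" and z: "z \<in> - \<real>\<^sub>\<le>\<^sub>0"
    let ?C = "C - mat (of_nat k)"
    have reg: "poch_regular ?C" by (rule poch_regular_minus_of_nat[OF C]) (use inv k in auto)
    have S: "C - mat (of_nat (Suc k)) = ?C - mat 1" by (simp add: mat_add diff_diff_eq add_ac)
    have inv': "invertible (?C - mat 1)" using inv[of "Suc k"] k unfolding S by simp
    have P: "?P (Suc k) = (?C - mat 1) ** ?P k"
    proof -
      have eq: "mat 1 - C + mat (of_nat k) = - (?C - mat 1)" by simp
      have comm: "mat_poch (mat 1 - C) k ** (?C - mat 1) = (?C - mat 1) ** mat_poch (mat 1 - C) k"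
      proof (rule mat_poch_commute)
        have "C ** (C + mat (- of_nat k - 1)) = (C + mat (- of_nat k - 1)) ** C"
          by (rule add_mat_commute[symmetric]) simp
        moreover have "C + mat (- of_nat k - 1) = ?C - mat 1"
          by (auto simp: vec_eq_iff mat_def)
        ultimately show "(mat 1 - C) ** (?C - mat 1) = (?C - mat 1) ** (mat 1 - C)"
          by (intro one_minus_commute) simp
      qed
      have "mat_poch (mat 1 - C) (Suc k) = - (mat_poch (mat 1 - C) k ** (?C - mat 1))"
        unfolding mat_poch.simps eq by (rule matrix_mult_uminus_right)
      thus ?thesis unfolding comm by (simp add: mat_scale_mult_right vec_eq_iff)
    qed
    have "mat_has_deriv (\<lambda>z. mat 1 ** (horn_H5 A ?C z y ** mat_powr z (?C - mat 1)) ** ?P k)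
      (mat 1 ** (horn_H5 A (?C - mat 1) z y ** mat_powr z (?C - mat 1 - mat 1) ** (?C - mat 1)) ** ?P k) z"
      using z by (intro mat_has_deriv_cmult horn_H5_powr_has_deriv_x A reg inv') auto
    thus "mat_has_deriv (?G k) (?G (Suc k) z) z"
      unfolding S P by (simp only: matrix_mul_lid matrix_mul_assoc)
  qed (use x in auto)
  moreover have "C - mat (of_nat r) - mat 1 = C - mat (of_nat (r + 1))"
    by (simp add: mat_add diff_diff_eq)
  ultimately show ?thesis by (simp add: mat_scale_mult_right)
qed

theorem theorem4p17:
  fixes A C :: "complex^'d^'d" and r :: nat
  assumes C_inv: "\<And>k::nat. invertible (C + mat (of_nat k))"
    and A_inv: "\<And>k::nat. k \<ge> 1 \<Longrightarrow> invertible (A - mat (of_nat k))"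
    and r_pos: "r \<ge> 1"
  shows
    "((\<forall>k<r. invertible (A + mat (of_nat k))) \<longrightarrow>
       (\<forall>y. mat_holomorphic_on (\<lambda>z. horn_H5 A C z y) UNIV \<and>
         (\<forall>x. (mat_deriv ^^ r) (\<lambda>z. horn_H5 A C z y) x
            = mat_poch A r ** horn_H5 (A + mat (of_nat r)) (C + mat (of_nat r)) x y
                ** matrix_inv (mat_poch C r))))
   \<and> (\<forall>x. mat_holomorphic_on (\<lambda>w. horn_H5 A C x w) UNIV \<and>
         (\<forall>y. (mat_deriv ^^ r) (\<lambda>w. horn_H5 A C x w) y
            = (-1) ^ r *k (matrix_inv (mat_poch (mat 1 - A) r)
                ** horn_H5 (A - mat (of_nat r)) C x y)))
   \<and> ((\<forall>k<r. invertible (A + mat (of_nat k))) \<longrightarrow>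
       (\<forall>y. mat_holomorphic_on (\<lambda>z. mat_powr z A ** horn_H5 A C z (y / z)) (- \<real>\<^sub>\<le>\<^sub>0) \<and>
         (\<forall>x. x \<notin> \<real>\<^sub>\<le>\<^sub>0 \<longrightarrow>
            ((\<lambda>F z. z\<^sup>2 *k mat_deriv F z) ^^ r) (\<lambda>z. mat_powr z A ** horn_H5 A C z (y / z)) x
            = mat_powr x (A + mat (of_nat r)) ** mat_poch A r
                ** horn_H5 (A + mat (of_nat r)) C x (y / x))))
   \<and> ((\<forall>k. 1 \<le> k \<and> k \<le> r \<longrightarrow> invertible (C - mat (of_nat k))) \<longrightarrow>
       (\<forall>y. mat_holomorphic_on (\<lambda>z. horn_H5 A C z y ** mat_powr z (C - mat 1)) (- \<real>\<^sub>\<le>\<^sub>0) \<and>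
         (\<forall>x. x \<notin> \<real>\<^sub>\<le>\<^sub>0 \<longrightarrow>
            (mat_deriv ^^ r) (\<lambda>z. horn_H5 A C z y ** mat_powr z (C - mat 1)) x
            = (-1) ^ r *k (horn_H5 A (C - mat (of_nat r)) x y
                ** mat_powr x (C - mat (of_nat (r + 1))) ** mat_poch (mat 1 - C) r))))"
proof -
  have C: "poch_regular C" using C_inv by (simp add: poch_regular_def)
  have A: "poch_regular (mat 1 - A)"
    unfolding poch_regular_def
  proof
    fix k :: nat
    have eq: "mat 1 - A + mat (of_nat k) = - (A - mat (of_nat (k + 1)))" by (simp add: mat_add)
    show "invertible (mat 1 - A + mat (of_nat k))"
      unfolding eq by (intro matrix_inv_uminus(2) A_inv) simp
  qed
  have A0: "invertible A" if "\<forall>k<r. invertible (A + mat (of_nat k))"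
    using that r_pos by (auto dest: spec[of _ 0])
  have C1: "invertible (C - mat 1)" if "\<forall>k. 1 \<le> k \<and> k \<le> r \<longrightarrow> invertible (C - mat (of_nat k))"
    using that r_pos by (auto dest: spec[of _ 1])
  have hol1: "mat_holomorphic_on (\<lambda>z. horn_H5 A C z y) UNIV" if "invertible A" for y
    by (rule mat_holomorphic_onI[OF open_UNIV horn_H5_has_deriv_x[OF A C that]])
  have hol2: "mat_holomorphic_on (\<lambda>w. horn_H5 A C x w) UNIV" for x
    by (rule mat_holomorphic_onI[OF open_UNIV horn_H5_has_deriv_y[OF A C]])
  have hol3: "mat_holomorphic_on (\<lambda>z. mat_powr z A ** horn_H5 A C z (y / z)) (- \<real>\<^sub>\<le>\<^sub>0)"
    if "invertible A" for y
  proof (rule mat_holomorphic_onI[OF open_slit_plane])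
    fix z :: complex assume z: "z \<in> - \<real>\<^sub>\<le>\<^sub>0"
    show "mat_has_deriv (\<lambda>z. mat_powr z A ** horn_H5 A C z (y / z))
      (mat_deriv (\<lambda>z. mat_powr z A ** horn_H5 A C z (y / z)) z) z"
      using horn_H5_powr_has_deriv_quotient[OF A that C, of z y] z
      by (metis ComplD mat_has_deriv_imp_mat_deriv)
  qed
  have hol4: "mat_holomorphic_on (\<lambda>z. horn_H5 A C z y ** mat_powr z (C - mat 1)) (- \<real>\<^sub>\<le>\<^sub>0)"
    if "invertible (C - mat 1)" for y
    by (rule mat_holomorphic_onI[OF open_slit_plane horn_H5_powr_has_deriv_x[OF A C that]]) auto
  show ?thesis
    using hol1 hol2 hol3 hol4 A0 C1 horn_H5_iterated_deriv_x[OF A C] horn_H5_iterated_deriv_y[OF A C]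
      horn_H5_iterated_deriv_quotient[OF A C] horn_H5_iterated_deriv_powr[OF A C]
    by (intro conjI impI allI) blast+
qed

end
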